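(* Let $\mathcal{M}$ be a left module category over a pivotal fusion category $\mathcal{C}$. The following structures on $\mathcal{M}$ are in canonical one-to-one correspondence, under $\eta_{m,n}(f)(g)=\Theta_m(g\circ f)$ for $f\in\mathrm{Hom}_{\mathcal{M}}(m,n)$, $g\in\mathrm{Hom}_{\mathcal{M}}(n,m)$: (i) a $\mathcal{C}$-module trace $\Theta$ on $\mathcal{M}$; (ii) a $\mathcal{C}$-balanced natural isomorphism $\eta:\mathrm{Hom}_{\mathcal{M}}(m,n)\to\mathrm{Hom}_{\mathcal{M}}(n,m)^{*}$.
   Context: All categories are abelian and locally finite over $\mathbb{C}$. A fusion category is a semisimple rigid monoidal $\mathbb{C}$-linear category with tensor product bilinear on morphisms, simple unit $1$ and finitely many isomorphism classes of simple objects (treated as strict). The right dual of $c$ is $c^{*}$ with $\mathrm{ev}_c:c^{*}\otimes c\to1$, $\mathrm{coev}_c:1\to c\otimes c^{*}$; the left dual is ${}^{*}c$ with $\mathrm{ev}'_c:c\otimes{}^{*}c\to1$, $\mathrm{coev}'_c:1\to{}^{*}c\otimes c$; $({}^{*}c)^{*}\cong c\cong{}^{*}(c^{*})$ canonically, treated as identities. A pivotal structure is a monoidal natural isomorphism $a:\mathrm{id}\to(-)^{**}$. A left $\mathcal{C}$-module category is a semisimple $\mathbb{C}$-linear abelian category $\mathcal{M}$ with a bifunctor $\triangleright:\mathcal{C}\times\mathcal{M}\to\mathcal{M}$ and natural isomorphisms $(c\otimes d)\triangleright m\cong c\triangleright(d\triangleright m)$, $1\triangleright m\cong m$ satisfying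 the usual pentagon and triangle axioms (suppressed below). For $f\in\mathrm{End}_{\mathcal{M}}(c\triangleright m)$ put $\mathrm{tr}^{\mathcal{C}}(f)=(\mathrm{ev}_c\triangleright\mathrm{id}_m)\circ(a_{{}^{*}c}\triangleright f)\circ(\mathrm{coev}'_c\triangleright\mathrm{id}_m)$. A $\mathcal{C}$-module trace on $\mathcal{M}$ is a family of linear maps $\Theta_m:\mathrm{End}_{\mathcal{M}}(m)\to\mathbb{C}$ that is symmetric ($\Theta_m(g\circ f)=\Theta_n(f\circ g)$ for $f:m\to n$, $g:n\to m$), non-degenerate (the pairing $(f,g)\mapsto\Theta_m(g\circ f)$ on $\mathrm{Hom}(m,n)\times\mathrm{Hom}(n,m)$ is non-degenerate for all $m,n$) and $\mathcal{C}$-compatible ($\Theta_{c\triangleright m}=\Theta_m\circ\mathrm{tr}^{\mathcal{C}}$). The category $\mathcal{M}^{\mathrm{op}}$ is a right $\mathcal{C}$-module category via $m\triangleleft c=c^{*}\triangleright m$. A $\mathcal{C}$-balanced functor $F:\mathcal{M}^{\mathrm{op}}\times\mathcal{M}\to\mathrm{Vect}$ is one with coherent natural isomorphisms $F(m\triangleleft c,n)\cong F(m,c\triangleright n)$; a natural transformation between balanced functors is $\mathcal{C}$-balanced if it commutes with these isomorphisms. The functor $(m,n)\mapsto\mathrm{Hom}_{\mathcal{M}}(m,n)$ is balanced via the duality isomorphism $\mathrm{Hom}(m,c\triangleright n)\cong\mathrm{Hom}(c^{*}\triangleright m,n)$, $f\mapsto\hat f=(\mathrm{ev}_c\triangleright\mathrm{id}_n)\circ(\mathrm{id}_{c^{*}}\triangleright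 f)$. The functor $(m,n)\mapsto\mathrm{Hom}_{\mathcal{M}}(n,m)^{*}$ is balanced via the dual of the isomorphism $\mathrm{Hom}(c\triangleright n,m)\cong\mathrm{Hom}(n,{}^{*}c\triangleright m)\cong\mathrm{Hom}(n,c^{*}\triangleright m)$, $g\mapsto\hat g=(a_{{}^{*}c}\triangleright g)\circ(\mathrm{coev}'_c\triangleright\mathrm{id}_n)$. Thus $\eta$ is $\mathcal{C}$-balanced iff $\eta_{m,c\triangleright n}(f)(g)=\eta_{c^{*}\triangleright m,n}(\hat f)(\hat g)$ for all $c,m,n$ and all $f:m\to c\triangleright n$, $g:c\triangleright n\to m$. *)

theory Defs
  imports Complex_Main "HOL-Algebra.Module"
begin

section \<open>Complex vector spaces\<close>

definition complex_field :: "complex ring" where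
  "complex_field = \<lparr>carrier = UNIV, monoid.mult = (*), one = 1, ring.zero = 0, add = (+)\<rparr>"

text \<open>A complex vector space is a record \<open>V\<close> with \<open>module complex_field V\<close>. The fields
  \<open>mult\<close> and \<open>one\<close>, inherited from the ring record, are not used.\<close>

definition finite_dimensional :: "(complex, 'v) module \<Rightarrow> bool" where
  "finite_dimensional V \<longleftrightarrow> (\<exists>B. finite B \<and> B \<subseteq> carrier V \<and>
     (\<forall>v \<in> carrier V. \<exists>a. v = (\<Oplus>\<^bsub>V\<^esub>b\<in>B. a b \<odot>\<^bsub>V\<^esub> b)))"

definition linear_map :: "(complex, 'v) module \<Rightarrow> (complex, 'w) module \<Rightarrow> ('v \<Rightarrow> 'w) \<Rightarrow> bool" where
  "linear_map V W T \<longleftrightarrow> T \<in> carrier V \<rightarrow> carrier W \<and>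
     (\<forall>u \<in> carrier V. \<forall>v \<in> carrier V. T (u \<oplus>\<^bsub>V\<^esub> v) = T u \<oplus>\<^bsub>W\<^esub> T v) \<and>
     (\<forall>a. \<forall>v \<in> carrier V. T (a \<odot>\<^bsub>V\<^esub> v) = a \<odot>\<^bsub>W\<^esub> T v)"

text \<open>Linear forms are extensional, so that a linear form on \<open>V\<close> is determined by its values
  on \<open>carrier V\<close>.\<close>

definition linear_form :: "(complex, 'v) module \<Rightarrow> ('v \<Rightarrow> complex) \<Rightarrow> bool" where
  "linear_form V \<phi> \<longleftrightarrow> \<phi> \<in> extensional (carrier V) \<and>
     (\<forall>u \<in> carrier V. \<forall>v \<in> carrier V. \<phi> (u \<oplus>\<^bsub>V\<^esub> v) = \<phi> u + \<phi> v) \<and>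
     (\<forall>a. \<forall>v \<in> carrier V. \<phi> (a \<odot>\<^bsub>V\<^esub> v) = a * \<phi> v)"

definition dual_space :: "(complex, 'v) module \<Rightarrow> (complex, 'v \<Rightarrow> complex) module" where
  "dual_space V = \<lparr>carrier = {\<phi>. linear_form V \<phi>}, monoid.mult = undefined, one = undefined,
     ring.zero = (\<lambda>v \<in> carrier V. 0),
     add = (\<lambda>\<phi> \<psi>. \<lambda>v \<in> carrier V. \<phi> v + \<psi> v),
     smult = (\<lambda>a \<phi>. \<lambda>v \<in> carrier V. a * \<phi> v)\<rparr>"


section \<open>Linear and abelian categories\<close>

text \<open>The objects are all elements of the type \<open>'o\<close>; \<open>Hom C x y\<close> is the space of morphisms
  from \<open>x\<close> to \<open>y\<close>, with underlying set \<open>Mor C x y\<close>. As usual for categories, morphisms are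
  composed without mentioning their domains; \<open>g \<cdot> f\<close> is ``\<open>g\<close> after \<open>f\<close>''. Values of the
  operations outside the relevant Hom-spaces are irrelevant.\<close>

record ('o, 'h) lin_cat =
  Hom :: "'o \<Rightarrow> 'o \<Rightarrow> (complex, 'h) module"
  idm :: "'o \<Rightarrow> 'h"
  cmp :: "'h \<Rightarrow> 'h \<Rightarrow> 'h"  (infixl "\<cdot>\<index>" 65)

abbreviation Mor :: "('o, 'h, 'z) lin_cat_scheme \<Rightarrow> 'o \<Rightarrow> 'o \<Rightarrow> 'h set" where
  "Mor C x y \<equiv> carrier (Hom C x y)"

locale linear_category =
  fixes C :: "('o, 'h, 'z) lin_cat_scheme" (structure)
  assumes Hom_module: "module complex_field (Hom C x y)"
    and idm_closed: "idm C x \<in> Mor C x x"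
    and cmp_closed: "\<lbrakk>f \<in> Mor C x y; g \<in> Mor C y z\<rbrakk> \<Longrightarrow> g \<cdot> f \<in> Mor C x z"
    and cmp_assoc: "\<lbrakk>f \<in> Mor C w x; g \<in> Mor C x y; h \<in> Mor C y z\<rbrakk> \<Longrightarrow> (h \<cdot> g) \<cdot> f = h \<cdot> (g \<cdot> f)"
    and cmp_idm: "f \<in> Mor C x y \<Longrightarrow> f \<cdot> idm C x = f"
    and idm_cmp: "f \<in> Mor C x y \<Longrightarrow> idm C y \<cdot> f = f"
    and cmp_add_right: "\<lbrakk>f \<in> Mor C x y; f' \<in> Mor C x y; g \<in> Mor C y z\<rbrakk>
      \<Longrightarrow> g \<cdot> (f \<oplus>\<^bsub>Hom C x y\<^esub> f') = (g \<cdot> f) \<oplus>\<^bsub>Hom C x z\<^esub> (g \<cdot> f')"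
    and cmp_add_left: "\<lbrakk>f \<in> Mor C x y; g \<in> Mor C y z; g' \<in> Mor C y z\<rbrakk>
      \<Longrightarrow> (g \<oplus>\<^bsub>Hom C y z\<^esub> g') \<cdot> f = (g \<cdot> f) \<oplus>\<^bsub>Hom C x z\<^esub> (g' \<cdot> f)"
    and cmp_smult_right: "\<lbrakk>f \<in> Mor C x y; g \<in> Mor C y z\<rbrakk>
      \<Longrightarrow> g \<cdot> (a \<odot>\<^bsub>Hom C x y\<^esub> f) = a \<odot>\<^bsub>Hom C x z\<^esub> (g \<cdot> f)"
    and cmp_smult_left: "\<lbrakk>f \<in> Mor C x y; g \<in> Mor C y z\<rbrakk>
      \<Longrightarrow> (a \<odot>\<^bsub>Hom C y z\<^esub> g) \<cdot> f = a \<odot>\<^bsub>Hom C x z\<^esub> (g \<cdot> f)"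

definition inverse_mor :: "('o, 'h, 'z) lin_cat_scheme \<Rightarrow> 'o \<Rightarrow> 'o \<Rightarrow> 'h \<Rightarrow> 'h \<Rightarrow> bool" where
  "inverse_mor C x y f g \<longleftrightarrow> f \<in> Mor C x y \<and> g \<in> Mor C y x \<and>
     g \<cdot>\<^bsub>C\<^esub> f = idm C x \<and> f \<cdot>\<^bsub>C\<^esub> g = idm C y"

definition iso_mor :: "('o, 'h, 'z) lin_cat_scheme \<Rightarrow> 'o \<Rightarrow> 'o \<Rightarrow> 'h \<Rightarrow> bool" where
  "iso_mor C x y f \<longleftrightarrow> (\<exists>g. inverse_mor C x y f g)"

definition inv_mor :: "('o, 'h, 'z) lin_cat_scheme \<Rightarrow> 'o \<Rightarrow> 'o \<Rightarrow> 'h \<Rightarrow> 'h" where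
  "inv_mor C x y f = (THE g. inverse_mor C x y f g)"

definition isomorphic :: "('o, 'h, 'z) lin_cat_scheme \<Rightarrow> 'o \<Rightarrow> 'o \<Rightarrow> bool" where
  "isomorphic C x y \<longleftrightarrow> (\<exists>f. iso_mor C x y f)"

definition mono_mor :: "('o, 'h, 'z) lin_cat_scheme \<Rightarrow> 'o \<Rightarrow> 'o \<Rightarrow> 'h \<Rightarrow> bool" where
  "mono_mor C x y f \<longleftrightarrow> f \<in> Mor C x y \<and>
     (\<forall>z. \<forall>u \<in> Mor C z x. \<forall>v \<in> Mor C z x. f \<cdot>\<^bsub>C\<^esub> u = f \<cdot>\<^bsub>C\<^esub> v \<longrightarrow> u = v)"

definition epi_mor :: "('o, 'h, 'z) lin_cat_scheme \<Rightarrow> 'o \<Rightarrow> 'o \<Rightarrow> 'h \<Rightarrow> bool" where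
  "epi_mor C x y f \<longleftrightarrow> f \<in> Mor C x y \<and>
     (\<forall>z. \<forall>u \<in> Mor C y z. \<forall>v \<in> Mor C y z. u \<cdot>\<^bsub>C\<^esub> f = v \<cdot>\<^bsub>C\<^esub> f \<longrightarrow> u = v)"

definition zero_object :: "('o, 'h, 'z) lin_cat_scheme \<Rightarrow> 'o \<Rightarrow> bool" where
  "zero_object C z \<longleftrightarrow> (\<forall>x. (\<exists>!f. f \<in> Mor C z x) \<and> (\<exists>!f. f \<in> Mor C x z))"

text \<open>\<open>k\<close> together with \<open>i : k \<rightarrow> x\<close> is a kernel of \<open>f : x \<rightarrow> y\<close>, and dually for cokernels.\<close>

definition is_kernel :: "('o, 'h, 'z) lin_cat_scheme \<Rightarrow> 'o \<Rightarrow> 'o \<Rightarrow> 'h \<Rightarrow> 'o \<Rightarrow> 'h \<Rightarrow> bool" where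
  "is_kernel C x y f k i \<longleftrightarrow> i \<in> Mor C k x \<and> f \<cdot>\<^bsub>C\<^esub> i = \<zero>\<^bsub>Hom C k y\<^esub> \<and>
     (\<forall>z. \<forall>h \<in> Mor C z x. f \<cdot>\<^bsub>C\<^esub> h = \<zero>\<^bsub>Hom C z y\<^esub> \<longrightarrow> (\<exists>!t. t \<in> Mor C z k \<and> i \<cdot>\<^bsub>C\<^esub> t = h))"

definition is_cokernel :: "('o, 'h, 'z) lin_cat_scheme \<Rightarrow> 'o \<Rightarrow> 'o \<Rightarrow> 'h \<Rightarrow> 'o \<Rightarrow> 'h \<Rightarrow> bool" where
  "is_cokernel C x y f q p \<longleftrightarrow> p \<in> Mor C y q \<and> p \<cdot>\<^bsub>C\<^esub> f = \<zero>\<^bsub>Hom C x q\<^esub> \<and>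
     (\<forall>z. \<forall>h \<in> Mor C y z. h \<cdot>\<^bsub>C\<^esub> f = \<zero>\<^bsub>Hom C x z\<^esub> \<longrightarrow> (\<exists>!t. t \<in> Mor C q z \<and> t \<cdot>\<^bsub>C\<^esub> p = h))"

text \<open>\<open>s\<close> is the direct sum of the objects \<open>X i\<close>, \<open>i < n\<close>, with inclusions \<open>\<iota> i\<close> and
  projections \<open>\<pi> i\<close>.\<close>

definition is_direct_sum ::
  "('o, 'h, 'z) lin_cat_scheme \<Rightarrow> nat \<Rightarrow> (nat \<Rightarrow> 'o) \<Rightarrow> 'o \<Rightarrow> (nat \<Rightarrow> 'h) \<Rightarrow> (nat \<Rightarrow> 'h) \<Rightarrow> bool" where
  "is_direct_sum C n X s \<iota> \<pi> \<longleftrightarrow>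
     (\<forall>i<n. \<iota> i \<in> Mor C (X i) s \<and> \<pi> i \<in> Mor C s (X i) \<and> \<pi> i \<cdot>\<^bsub>C\<^esub> \<iota> i = idm C (X i)) \<and>
     (\<forall>i<n. \<forall>j<n. i \<noteq> j \<longrightarrow> \<pi> j \<cdot>\<^bsub>C\<^esub> \<iota> i = \<zero>\<^bsub>Hom C (X i) (X j)\<^esub>) \<and>
     (\<Oplus>\<^bsub>Hom C s s\<^esub>i\<in>{..<n}. \<iota> i \<cdot>\<^bsub>C\<^esub> \<pi> i) = idm C s"

definition simple_object :: "('o, 'h, 'z) lin_cat_scheme \<Rightarrow> 'o \<Rightarrow> bool" where
  "simple_object C x \<longleftrightarrow> \<not> zero_object C x \<and>
     (\<forall>y i. mono_mor C y x i \<longrightarrow> zero_object C y \<or> iso_mor C y x i)"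

text \<open>In the second rule \<open>0 \<rightarrow> y \<rightarrow> x \<rightarrow> s \<rightarrow> 0\<close> is a short exact sequence with \<open>s\<close> simple.\<close>

inductive finite_length :: "('o, 'h, 'z) lin_cat_scheme \<Rightarrow> 'o \<Rightarrow> bool"
  for C :: "('o, 'h, 'z) lin_cat_scheme" where
  "zero_object C x \<Longrightarrow> finite_length C x"
| "\<lbrakk>finite_length C y; simple_object C s; is_kernel C x s p y i; is_cokernel C y x i s p\<rbrakk>
     \<Longrightarrow> finite_length C x"

locale abelian_category = linear_category +
  assumes ex_zero_object: "\<exists>z. zero_object C z"
    and ex_direct_sum: "\<exists>s \<iota> \<pi>. is_direct_sum C 2 X s \<iota> \<pi>"
    and ex_kernel: "f \<in> Mor C x y \<Longrightarrow> \<exists>k i. is_kernel C x y f k i"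
    and ex_cokernel: "f \<in> Mor C x y \<Longrightarrow> \<exists>q p. is_cokernel C x y f q p"
    and mono_kernel: "mono_mor C x y f \<Longrightarrow> \<exists>z g. g \<in> Mor C y z \<and> is_kernel C y z g x f"
    and epi_cokernel: "epi_mor C x y f \<Longrightarrow> \<exists>w g. g \<in> Mor C w x \<and> is_cokernel C w x g y f"

locale locally_finite_category = abelian_category +
  assumes finite_dimensional_Hom: "finite_dimensional (Hom C x y)"
    and finite_length_object: "finite_length C x"

locale semisimple_category = locally_finite_category +
  assumes semisimple:
    "\<exists>n X \<iota> \<pi>. (\<forall>i<n. simple_object C (X i)) \<and> is_direct_sum C n X x \<iota> \<pi>"


section \<open>Fusion categories\<close>

text \<open>Monoidal categories are not assumed strict: \<open>asc C x y z : (x \<boxtimes> y) \<boxtimes> z \<rightarrow> x \<boxtimes> (y \<boxtimes> z)\<close>,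
  \<open>lun C x : 1 \<boxtimes> x \<rightarrow> x\<close> and \<open>run C x : x \<boxtimes> 1 \<rightarrow> x\<close>. The tensor product of morphisms is
  written \<open>\<boxtimes>\<^sub>h\<close>. The right dual of \<open>x\<close> is \<open>rd C x\<close> with \<open>ev C x : rd C x \<boxtimes> x \<rightarrow> 1\<close> and
  \<open>coev C x : 1 \<rightarrow> x \<boxtimes> rd C x\<close>; the left dual is \<open>ld C x\<close> with
  \<open>ev' C x : x \<boxtimes> ld C x \<rightarrow> 1\<close> and \<open>coev' C x : 1 \<rightarrow> ld C x \<boxtimes> x\<close>.\<close>

record ('o, 'h) mon_cat = "('o, 'h) lin_cat" +
  unt :: 'o
  tns :: "'o \<Rightarrow> 'o \<Rightarrow> 'o"  (infixl "\<boxtimes>\<index>" 70)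
  tnsh :: "'h \<Rightarrow> 'h \<Rightarrow> 'h"  (infixl "\<boxtimes>\<^sub>h\<index>" 70)
  asc :: "'o \<Rightarrow> 'o \<Rightarrow> 'o \<Rightarrow> 'h"
  lun :: "'o \<Rightarrow> 'h"
  run :: "'o \<Rightarrow> 'h"

record ('o, 'h) rigid_cat = "('o, 'h) mon_cat" +
  rd :: "'o \<Rightarrow> 'o"
  ev :: "'o \<Rightarrow> 'h"
  coev :: "'o \<Rightarrow> 'h"
  ld :: "'o \<Rightarrow> 'o"
  ev' :: "'o \<Rightarrow> 'h"
  coev' :: "'o \<Rightarrow> 'h"

abbreviation asc_inv :: "('o, 'h, 'z) mon_cat_scheme \<Rightarrow> 'o \<Rightarrow> 'o \<Rightarrow> 'o \<Rightarrow> 'h" where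
  "asc_inv C x y z \<equiv> inv_mor C ((x \<boxtimes>\<^bsub>C\<^esub> y) \<boxtimes>\<^bsub>C\<^esub> z) (x \<boxtimes>\<^bsub>C\<^esub> (y \<boxtimes>\<^bsub>C\<^esub> z)) (asc C x y z)"

abbreviation lun_inv :: "('o, 'h, 'z) mon_cat_scheme \<Rightarrow> 'o \<Rightarrow> 'h" where
  "lun_inv C x \<equiv> inv_mor C (unt C \<boxtimes>\<^bsub>C\<^esub> x) x (lun C x)"

abbreviation run_inv :: "('o, 'h, 'z) mon_cat_scheme \<Rightarrow> 'o \<Rightarrow> 'h" where
  "run_inv C x \<equiv> inv_mor C (x \<boxtimes>\<^bsub>C\<^esub> unt C) x (run C x)"

locale monoidal_category = linear_category C
  for C :: "('o, 'h, 'z) mon_cat_scheme" (structure) +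
  assumes tnsh_closed: "\<lbrakk>f \<in> Mor C x x'; g \<in> Mor C y y'\<rbrakk> \<Longrightarrow> f \<boxtimes>\<^sub>h g \<in> Mor C (x \<boxtimes> y) (x' \<boxtimes> y')"
    and tnsh_idm: "idm C x \<boxtimes>\<^sub>h idm C y = idm C (x \<boxtimes> y)"
    and tnsh_cmp: "\<lbrakk>f \<in> Mor C x x'; f' \<in> Mor C x' x''; g \<in> Mor C y y'; g' \<in> Mor C y' y''\<rbrakk>
      \<Longrightarrow> (f' \<cdot> f) \<boxtimes>\<^sub>h (g' \<cdot> g) = (f' \<boxtimes>\<^sub>h g') \<cdot> (f \<boxtimes>\<^sub>h g)"
    and asc_iso: "iso_mor C ((x \<boxtimes> y) \<boxtimes> z) (x \<boxtimes> (y \<boxtimes> z)) (asc C x y z)"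
    and lun_iso: "iso_mor C (unt C \<boxtimes> x) x (lun C x)"
    and run_iso: "iso_mor C (x \<boxtimes> unt C) x (run C x)"
    and asc_natural: "\<lbrakk>f \<in> Mor C x x'; g \<in> Mor C y y'; h \<in> Mor C z z'\<rbrakk>
      \<Longrightarrow> asc C x' y' z' \<cdot> ((f \<boxtimes>\<^sub>h g) \<boxtimes>\<^sub>h h) = (f \<boxtimes>\<^sub>h (g \<boxtimes>\<^sub>h h)) \<cdot> asc C x y z"
    and lun_natural: "f \<in> Mor C x y \<Longrightarrow> lun C y \<cdot> (idm C (unt C) \<boxtimes>\<^sub>h f) = f \<cdot> lun C x"
    and run_natural: "f \<in> Mor C x y \<Longrightarrow> run C y \<cdot> (f \<boxtimes>\<^sub>h idm C (unt C)) = f \<cdot> run C x"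
    and pentagon: "asc C w x (y \<boxtimes> z) \<cdot> asc C (w \<boxtimes> x) y z
      = (idm C w \<boxtimes>\<^sub>h asc C x y z) \<cdot> asc C w (x \<boxtimes> y) z \<cdot> (asc C w x y \<boxtimes>\<^sub>h idm C z)"
    and triangle: "(idm C x \<boxtimes>\<^sub>h lun C y) \<cdot> asc C x (unt C) y = run C x \<boxtimes>\<^sub>h idm C y"

text \<open>\<open>y\<close> is a right dual of \<open>x\<close> (equivalently, \<open>x\<close> is a left dual of \<open>y\<close>) with evaluation
  \<open>e : y \<boxtimes> x \<rightarrow> 1\<close> and coevaluation \<open>k : 1 \<rightarrow> x \<boxtimes> y\<close>.\<close>

definition duality ::
  "('o, 'h, 'z) mon_cat_scheme \<Rightarrow> 'o \<Rightarrow> 'o \<Rightarrow> 'h \<Rightarrow> 'h \<Rightarrow> bool" where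
  "duality C x y e k \<longleftrightarrow>
     e \<in> Mor C (y \<boxtimes>\<^bsub>C\<^esub> x) (unt C) \<and> k \<in> Mor C (unt C) (x \<boxtimes>\<^bsub>C\<^esub> y) \<and>
     run C x \<cdot>\<^bsub>C\<^esub> (idm C x \<boxtimes>\<^sub>h\<^bsub>C\<^esub> e) \<cdot>\<^bsub>C\<^esub> asc C x y x \<cdot>\<^bsub>C\<^esub> (k \<boxtimes>\<^sub>h\<^bsub>C\<^esub> idm C x) \<cdot>\<^bsub>C\<^esub> lun_inv C x
       = idm C x \<and>
     lun C y \<cdot>\<^bsub>C\<^esub> (e \<boxtimes>\<^sub>h\<^bsub>C\<^esub> idm C y) \<cdot>\<^bsub>C\<^esub> asc_inv C y x y \<cdot>\<^bsub>C\<^esub> (idm C y \<boxtimes>\<^sub>h\<^bsub>C\<^esub> k) \<cdot>\<^bsub>C\<^esub> run_inv C y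
       = idm C y"

locale fusion_category = monoidal_category C + semisimple_category C
  for C :: "('o, 'h, 'z) rigid_cat_scheme" (structure) +
  assumes tnsh_add_left: "\<lbrakk>f \<in> Mor C x x'; f' \<in> Mor C x x'; g \<in> Mor C y y'\<rbrakk>
      \<Longrightarrow> (f \<oplus>\<^bsub>Hom C x x'\<^esub> f') \<boxtimes>\<^sub>h g = (f \<boxtimes>\<^sub>h g) \<oplus>\<^bsub>Hom C (x \<boxtimes> y) (x' \<boxtimes> y')\<^esub> (f' \<boxtimes>\<^sub>h g)"
    and tnsh_add_right: "\<lbrakk>f \<in> Mor C x x'; g \<in> Mor C y y'; g' \<in> Mor C y y'\<rbrakk>
      \<Longrightarrow> f \<boxtimes>\<^sub>h (g \<oplus>\<^bsub>Hom C y y'\<^esub> g') = (f \<boxtimes>\<^sub>h g) \<oplus>\<^bsub>Hom C (x \<boxtimes> y) (x' \<boxtimes> y')\<^esub> (f \<boxtimes>\<^sub>h g')"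
    and tnsh_smult_left: "\<lbrakk>f \<in> Mor C x x'; g \<in> Mor C y y'\<rbrakk>
      \<Longrightarrow> (a \<odot>\<^bsub>Hom C x x'\<^esub> f) \<boxtimes>\<^sub>h g = a \<odot>\<^bsub>Hom C (x \<boxtimes> y) (x' \<boxtimes> y')\<^esub> (f \<boxtimes>\<^sub>h g)"
    and tnsh_smult_right: "\<lbrakk>f \<in> Mor C x x'; g \<in> Mor C y y'\<rbrakk>
      \<Longrightarrow> f \<boxtimes>\<^sub>h (a \<odot>\<^bsub>Hom C y y'\<^esub> g) = a \<odot>\<^bsub>Hom C (x \<boxtimes> y) (x' \<boxtimes> y')\<^esub> (f \<boxtimes>\<^sub>h g)"
    and right_dual: "duality C x (rd C x) (ev C x) (coev C x)"
    and left_dual: "duality C (ld C x) x (ev' C x) (coev' C x)"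
    and simple_unit: "simple_object C (unt C)"
    and finitely_many_simples:
      "\<exists>S. finite S \<and> (\<forall>x. simple_object C x \<longrightarrow> (\<exists>s \<in> S. isomorphic C x s))"


section \<open>Pivotal structures\<close>

text \<open>For a pairing \<open>e : y \<boxtimes> x \<rightarrow> 1\<close>, \<open>to_dual C y x e : y \<rightarrow> rd C x\<close> is the unique morphism
  \<open>t\<close> with \<open>ev C x \<cdot> (t \<boxtimes>\<^sub>h idm C x) = e\<close>. All canonical morphisms into duals arise
  from it.\<close>

definition to_dual :: "('o, 'h, 'z) rigid_cat_scheme \<Rightarrow> 'o \<Rightarrow> 'o \<Rightarrow> 'h \<Rightarrow> 'h" where
  "to_dual C y x e = lun C (rd C x) \<cdot>\<^bsub>C\<^esub> (e \<boxtimes>\<^sub>h\<^bsub>C\<^esub> idm C (rd C x)) \<cdot>\<^bsub>C\<^esub> asc_inv C y x (rd C x)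
     \<cdot>\<^bsub>C\<^esub> (idm C y \<boxtimes>\<^sub>h\<^bsub>C\<^esub> coev C x) \<cdot>\<^bsub>C\<^esub> run_inv C y"

text \<open>The dual \<open>rd C y \<rightarrow> rd C x\<close> of \<open>f : x \<rightarrow> y\<close>.\<close>

definition rd_mor :: "('o, 'h, 'z) rigid_cat_scheme \<Rightarrow> 'o \<Rightarrow> 'o \<Rightarrow> 'h \<Rightarrow> 'h" where
  "rd_mor C x y f = to_dual C (rd C y) x (ev C y \<cdot>\<^bsub>C\<^esub> (idm C (rd C y) \<boxtimes>\<^sub>h\<^bsub>C\<^esub> f))"

abbreviation rdd :: "('o, 'h, 'z) rigid_cat_scheme \<Rightarrow> 'o \<Rightarrow> 'o" where
  "rdd C x \<equiv> rd C (rd C x)"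

definition rdd_mor :: "('o, 'h, 'z) rigid_cat_scheme \<Rightarrow> 'o \<Rightarrow> 'o \<Rightarrow> 'h \<Rightarrow> 'h" where
  "rdd_mor C x y f = rd_mor C (rd C y) (rd C x) (rd_mor C x y f)"

text \<open>The canonical isomorphisms \<open>rd C y \<boxtimes> rd C x \<rightarrow> rd C (x \<boxtimes> y)\<close> and \<open>1 \<rightarrow> rd C 1\<close>, and
  the resulting monoidal structure of the double dual functor.\<close>

definition rd_tns :: "('o, 'h, 'z) rigid_cat_scheme \<Rightarrow> 'o \<Rightarrow> 'o \<Rightarrow> 'h" where
  "rd_tns C x y = to_dual C (rd C y \<boxtimes>\<^bsub>C\<^esub> rd C x) (x \<boxtimes>\<^bsub>C\<^esub> y)
     (ev C y \<cdot>\<^bsub>C\<^esub> (idm C (rd C y) \<boxtimes>\<^sub>h\<^bsub>C\<^esub>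
         (lun C y \<cdot>\<^bsub>C\<^esub> (ev C x \<boxtimes>\<^sub>h\<^bsub>C\<^esub> idm C y) \<cdot>\<^bsub>C\<^esub> asc_inv C (rd C x) x y))
      \<cdot>\<^bsub>C\<^esub> asc C (rd C y) (rd C x) (x \<boxtimes>\<^bsub>C\<^esub> y))"

definition rd_unt :: "('o, 'h, 'z) rigid_cat_scheme \<Rightarrow> 'h" where
  "rd_unt C = to_dual C (unt C) (unt C) (lun C (unt C))"

definition rdd_tns :: "('o, 'h, 'z) rigid_cat_scheme \<Rightarrow> 'o \<Rightarrow> 'o \<Rightarrow> 'h" where
  "rdd_tns C x y =
     rd_mor C (rd C (x \<boxtimes>\<^bsub>C\<^esub> y)) (rd C y \<boxtimes>\<^bsub>C\<^esub> rd C x)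
       (inv_mor C (rd C y \<boxtimes>\<^bsub>C\<^esub> rd C x) (rd C (x \<boxtimes>\<^bsub>C\<^esub> y)) (rd_tns C x y))
     \<cdot>\<^bsub>C\<^esub> rd_tns C (rd C y) (rd C x)"

definition rdd_unt :: "('o, 'h, 'z) rigid_cat_scheme \<Rightarrow> 'h" where
  "rdd_unt C = rd_mor C (rd C (unt C)) (unt C) (inv_mor C (unt C) (rd C (unt C)) (rd_unt C))
     \<cdot>\<^bsub>C\<^esub> rd_unt C"

definition pivotal_structure :: "('o, 'h, 'z) rigid_cat_scheme \<Rightarrow> ('o \<Rightarrow> 'h) \<Rightarrow> bool" where
  "pivotal_structure C a \<longleftrightarrow>
     (\<forall>x. iso_mor C x (rdd C x) (a x)) \<and>
     (\<forall>x y. \<forall>f \<in> Mor C x y. a y \<cdot>\<^bsub>C\<^esub> f = rdd_mor C x y f \<cdot>\<^bsub>C\<^esub> a x) \<and>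
     (\<forall>x y. a (x \<boxtimes>\<^bsub>C\<^esub> y) = rdd_tns C x y \<cdot>\<^bsub>C\<^esub> (a x \<boxtimes>\<^sub>h\<^bsub>C\<^esub> a y)) \<and>
     a (unt C) = rdd_unt C"

text \<open>The component of \<open>a\<close> at the left dual of \<open>c\<close>, as a morphism \<open>ld C c \<rightarrow> rd C c\<close>: it is
  followed by the dual of the canonical isomorphism \<open>c \<rightarrow> rd C (ld C c)\<close>, which identifies
  \<open>rdd C (ld C c)\<close> with \<open>rd C c\<close>.\<close>

definition piv_ld :: "('o, 'h, 'z) rigid_cat_scheme \<Rightarrow> ('o \<Rightarrow> 'h) \<Rightarrow> 'o \<Rightarrow> 'h" where
  "piv_ld C a c = rd_mor C c (rd C (ld C c)) (to_dual C c (ld C c) (ev' C c)) \<cdot>\<^bsub>C\<^esub> a (ld C c)"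


section \<open>Module categories and module traces\<close>

text \<open>\<open>masc M c d m : (c \<boxtimes> d) \<rhd> m \<rightarrow> c \<rhd> (d \<rhd> m)\<close> and \<open>mun M m : 1 \<rhd> m \<rightarrow> m\<close>. The action on
  morphisms is written \<open>\<rhd>\<^sub>h\<close>. It is only required to be a bifunctor; bilinearity
  of the action on morphisms is not imposed.\<close>

record ('n, 'k, 'o, 'h) mod_cat = "('n, 'k) lin_cat" +
  act :: "'o \<Rightarrow> 'n \<Rightarrow> 'n"  (infixr "\<rhd>\<index>" 70)
  acth :: "'h \<Rightarrow> 'k \<Rightarrow> 'k"  (infixr "\<rhd>\<^sub>h\<index>" 70)
  masc :: "'o \<Rightarrow> 'o \<Rightarrow> 'n \<Rightarrow> 'k"
  mun :: "'n \<Rightarrow> 'k"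

locale module_category = C: monoidal_category C + M: semisimple_category M
  for C :: "('o, 'h, 'z) rigid_cat_scheme" and M :: "('n, 'k, 'o, 'h, 'y) mod_cat_scheme" +
  assumes acth_closed: "\<lbrakk>f \<in> Mor C c c'; u \<in> Mor M m m'\<rbrakk>
      \<Longrightarrow> f \<rhd>\<^sub>h\<^bsub>M\<^esub> u \<in> Mor M (c \<rhd>\<^bsub>M\<^esub> m) (c' \<rhd>\<^bsub>M\<^esub> m')"
    and acth_idm: "idm C c \<rhd>\<^sub>h\<^bsub>M\<^esub> idm M m = idm M (c \<rhd>\<^bsub>M\<^esub> m)"
    and acth_cmp: "\<lbrakk>f \<in> Mor C c c'; f' \<in> Mor C c' c''; u \<in> Mor M m m'; u' \<in> Mor M m' m''\<rbrakk>
      \<Longrightarrow> (f' \<cdot>\<^bsub>C\<^esub> f) \<rhd>\<^sub>h\<^bsub>M\<^esub> (u' \<cdot>\<^bsub>M\<^esub> u) = (f' \<rhd>\<^sub>h\<^bsub>M\<^esub> u') \<cdot>\<^bsub>M\<^esub> (f \<rhd>\<^sub>h\<^bsub>M\<^esub> u)"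
    and masc_iso: "iso_mor M ((c \<boxtimes>\<^bsub>C\<^esub> d) \<rhd>\<^bsub>M\<^esub> m) (c \<rhd>\<^bsub>M\<^esub> (d \<rhd>\<^bsub>M\<^esub> m)) (masc M c d m)"
    and mun_iso: "iso_mor M (unt C \<rhd>\<^bsub>M\<^esub> m) m (mun M m)"
    and masc_natural: "\<lbrakk>f \<in> Mor C c c'; g \<in> Mor C d d'; u \<in> Mor M m m'\<rbrakk>
      \<Longrightarrow> masc M c' d' m' \<cdot>\<^bsub>M\<^esub> ((f \<boxtimes>\<^sub>h\<^bsub>C\<^esub> g) \<rhd>\<^sub>h\<^bsub>M\<^esub> u) = (f \<rhd>\<^sub>h\<^bsub>M\<^esub> (g \<rhd>\<^sub>h\<^bsub>M\<^esub> u)) \<cdot>\<^bsub>M\<^esub> masc M c d m"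
    and mun_natural: "u \<in> Mor M m m' \<Longrightarrow> mun M m' \<cdot>\<^bsub>M\<^esub> (idm C (unt C) \<rhd>\<^sub>h\<^bsub>M\<^esub> u) = u \<cdot>\<^bsub>M\<^esub> mun M m"
    and module_pentagon: "masc M c d (e \<rhd>\<^bsub>M\<^esub> m) \<cdot>\<^bsub>M\<^esub> masc M (c \<boxtimes>\<^bsub>C\<^esub> d) e m
      = (idm C c \<rhd>\<^sub>h\<^bsub>M\<^esub> masc M d e m) \<cdot>\<^bsub>M\<^esub> masc M c (d \<boxtimes>\<^bsub>C\<^esub> e) m \<cdot>\<^bsub>M\<^esub> (asc C c d e \<rhd>\<^sub>h\<^bsub>M\<^esub> idm M m)"
    and module_triangle:
      "(idm C c \<rhd>\<^sub>h\<^bsub>M\<^esub> mun M m) \<cdot>\<^bsub>M\<^esub> masc M c (unt C) m = run C c \<rhd>\<^sub>h\<^bsub>M\<^esub> idm M m"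

text \<open>\<open>mod_ev C M c m : rd C c \<rhd> (c \<rhd> m) \<rightarrow> m\<close> and \<open>mod_coev' C M c m : m \<rightarrow> ld C c \<rhd> (c \<rhd> m)\<close>
  are \<open>ev C c \<rhd>\<^sub>h id\<close> and \<open>coev' C c \<rhd>\<^sub>h id\<close> with the coherence isomorphisms of the action
  inserted.\<close>

definition mod_ev ::
  "('o, 'h, 'z) rigid_cat_scheme \<Rightarrow> ('n, 'k, 'o, 'h, 'y) mod_cat_scheme \<Rightarrow> 'o \<Rightarrow> 'n \<Rightarrow> 'k" where
  "mod_ev C M c m = mun M m \<cdot>\<^bsub>M\<^esub> (ev C c \<rhd>\<^sub>h\<^bsub>M\<^esub> idm M m) \<cdot>\<^bsub>M\<^esub>
     inv_mor M ((rd C c \<boxtimes>\<^bsub>C\<^esub> c) \<rhd>\<^bsub>M\<^esub> m) (rd C c \<rhd>\<^bsub>M\<^esub> (c \<rhd>\<^bsub>M\<^esub> m)) (masc M (rd C c) c m)"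

definition mod_coev' ::
  "('o, 'h, 'z) rigid_cat_scheme \<Rightarrow> ('n, 'k, 'o, 'h, 'y) mod_cat_scheme \<Rightarrow> 'o \<Rightarrow> 'n \<Rightarrow> 'k" where
  "mod_coev' C M c m = masc M (ld C c) c m \<cdot>\<^bsub>M\<^esub> (coev' C c \<rhd>\<^sub>h\<^bsub>M\<^esub> idm M m) \<cdot>\<^bsub>M\<^esub>
     inv_mor M (unt C \<rhd>\<^bsub>M\<^esub> m) m (mun M m)"

definition partial_trace ::
  "('o, 'h, 'z) rigid_cat_scheme \<Rightarrow> ('o \<Rightarrow> 'h) \<Rightarrow> ('n, 'k, 'o, 'h, 'y) mod_cat_scheme
    \<Rightarrow> 'o \<Rightarrow> 'n \<Rightarrow> 'k \<Rightarrow> 'k" where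
  "partial_trace C a M c m f = mod_ev C M c m \<cdot>\<^bsub>M\<^esub> (piv_ld C a c \<rhd>\<^sub>h\<^bsub>M\<^esub> f) \<cdot>\<^bsub>M\<^esub> mod_coev' C M c m"

definition module_trace ::
  "('o, 'h, 'z) rigid_cat_scheme \<Rightarrow> ('o \<Rightarrow> 'h) \<Rightarrow> ('n, 'k, 'o, 'h, 'y) mod_cat_scheme
    \<Rightarrow> ('n \<Rightarrow> 'k \<Rightarrow> complex) \<Rightarrow> bool" where
  "module_trace C a M \<Theta> \<longleftrightarrow>
     (\<forall>m. linear_form (Hom M m m) (\<Theta> m)) \<and>
     (\<forall>m n. \<forall>f \<in> Mor M m n. \<forall>g \<in> Mor M n m. \<Theta> m (g \<cdot>\<^bsub>M\<^esub> f) = \<Theta> n (f \<cdot>\<^bsub>M\<^esub> g)) \<and>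
     (\<forall>m n. \<forall>f \<in> Mor M m n. (\<forall>g \<in> Mor M n m. \<Theta> m (g \<cdot>\<^bsub>M\<^esub> f) = 0) \<longrightarrow> f = \<zero>\<^bsub>Hom M m n\<^esub>) \<and>
     (\<forall>m n. \<forall>g \<in> Mor M n m. (\<forall>f \<in> Mor M m n. \<Theta> m (g \<cdot>\<^bsub>M\<^esub> f) = 0) \<longrightarrow> g = \<zero>\<^bsub>Hom M n m\<^esub>) \<and>
     (\<forall>c m. \<forall>f \<in> Mor M (c \<rhd>\<^bsub>M\<^esub> m) (c \<rhd>\<^bsub>M\<^esub> m).
        \<Theta> (c \<rhd>\<^bsub>M\<^esub> m) f = \<Theta> m (partial_trace C a M c m f))"


section \<open>Balanced natural isomorphisms\<close>

text \<open>The action of the functors \<open>(m, n) \<mapsto> Hom M m n\<close> and \<open>(m, n) \<mapsto> dual_space (Hom M n m)\<close>,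
  contravariant in \<open>m\<close> and covariant in \<open>n\<close>, on a pair \<open>v : m' \<rightarrow> m\<close>, \<open>u : n \<rightarrow> n'\<close>.\<close>

definition Hom_map :: "('n, 'k, 'y) lin_cat_scheme \<Rightarrow> 'k \<Rightarrow> 'k \<Rightarrow> 'k \<Rightarrow> 'k" where
  "Hom_map M v u f = u \<cdot>\<^bsub>M\<^esub> f \<cdot>\<^bsub>M\<^esub> v"

definition Hom_dual_map ::
  "('n, 'k, 'y) lin_cat_scheme \<Rightarrow> 'n \<Rightarrow> 'n \<Rightarrow> 'k \<Rightarrow> 'k \<Rightarrow> ('k \<Rightarrow> complex) \<Rightarrow> 'k \<Rightarrow> complex" where
  "Hom_dual_map M m' n' v u \<phi> = (\<lambda>g \<in> Mor M n' m'. \<phi> (v \<cdot>\<^bsub>M\<^esub> g \<cdot>\<^bsub>M\<^esub> u))"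

text \<open>The balancing \<open>Hom(m, c \<rhd> n) \<rightarrow> Hom(rd c \<rhd> m, n)\<close> of the first functor; the isomorphism
  \<open>Hom(c \<rhd> n, m) \<rightarrow> Hom(n, rd c \<rhd> m)\<close>; and its transpose
  \<open>Hom(n, rd c \<rhd> m)\<^sup>* \<rightarrow> Hom(c \<rhd> n, m)\<^sup>*\<close>, the balancing of the second functor (as a map in
  the direction opposite to that of the first).\<close>

definition Hom_balancing ::
  "('o, 'h, 'z) rigid_cat_scheme \<Rightarrow> ('n, 'k, 'o, 'h, 'y) mod_cat_scheme \<Rightarrow> 'o \<Rightarrow> 'n \<Rightarrow> 'k \<Rightarrow> 'k" where
  "Hom_balancing C M c n f = mod_ev C M c n \<cdot>\<^bsub>M\<^esub> (idm C (rd C c) \<rhd>\<^sub>h\<^bsub>M\<^esub> f)"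

definition Hom_cobalancing ::
  "('o, 'h, 'z) rigid_cat_scheme \<Rightarrow> ('o \<Rightarrow> 'h) \<Rightarrow> ('n, 'k, 'o, 'h, 'y) mod_cat_scheme
    \<Rightarrow> 'o \<Rightarrow> 'n \<Rightarrow> 'k \<Rightarrow> 'k" where
  "Hom_cobalancing C a M c n g = (piv_ld C a c \<rhd>\<^sub>h\<^bsub>M\<^esub> g) \<cdot>\<^bsub>M\<^esub> mod_coev' C M c n"

definition Hom_dual_balancing ::
  "('o, 'h, 'z) rigid_cat_scheme \<Rightarrow> ('o \<Rightarrow> 'h) \<Rightarrow> ('n, 'k, 'o, 'h, 'y) mod_cat_scheme
    \<Rightarrow> 'o \<Rightarrow> 'n \<Rightarrow> 'n \<Rightarrow> ('k \<Rightarrow> complex) \<Rightarrow> 'k \<Rightarrow> complex" where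
  "Hom_dual_balancing C a M c m n \<phi> = (\<lambda>g \<in> Mor M (c \<rhd>\<^bsub>M\<^esub> n) m. \<phi> (Hom_cobalancing C a M c n g))"

text \<open>\<open>\<eta> m n\<close> is a map \<open>Hom(m, n) \<rightarrow> Hom(n, m)\<^sup>*\<close>; it is extensional, hence determined by its
  values on \<open>Mor M m n\<close>.\<close>

definition natural_iso_Hom_dual ::
  "('n, 'k, 'y) lin_cat_scheme \<Rightarrow> ('n \<Rightarrow> 'n \<Rightarrow> 'k \<Rightarrow> 'k \<Rightarrow> complex) \<Rightarrow> bool" where
  "natural_iso_Hom_dual M \<eta> \<longleftrightarrow>
     (\<forall>m n. \<eta> m n \<in> extensional (Mor M m n) \<and>
        linear_map (Hom M m n) (dual_space (Hom M n m)) (\<eta> m n) \<and>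
        bij_betw (\<eta> m n) (Mor M m n) (carrier (dual_space (Hom M n m)))) \<and>
     (\<forall>m n m' n'. \<forall>v \<in> Mor M m' m. \<forall>u \<in> Mor M n n'. \<forall>f \<in> Mor M m n.
        \<eta> m' n' (Hom_map M v u f) = Hom_dual_map M m' n' v u (\<eta> m n f))"

definition balanced ::
  "('o, 'h, 'z) rigid_cat_scheme \<Rightarrow> ('o \<Rightarrow> 'h) \<Rightarrow> ('n, 'k, 'o, 'h, 'y) mod_cat_scheme
    \<Rightarrow> ('n \<Rightarrow> 'n \<Rightarrow> 'k \<Rightarrow> 'k \<Rightarrow> complex) \<Rightarrow> bool" where
  "balanced C a M \<eta> \<longleftrightarrow>
     (\<forall>c m n. \<forall>f \<in> Mor M m (c \<rhd>\<^bsub>M\<^esub> n).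
        \<eta> m (c \<rhd>\<^bsub>M\<^esub> n) f =
          Hom_dual_balancing C a M c m n (\<eta> (rd C c \<rhd>\<^bsub>M\<^esub> m) n (Hom_balancing C M c n f)))"

end

theory Submission
  imports Defs
begin

text \<open>A trace and a natural transformation determine each other by \<open>\<Theta>\<^sub>m h = \<eta>\<^sub>m\<^sub>,\<^sub>m (id) h\<close>: naturality
  of \<open>\<eta>\<close> gives both \<open>\<eta>\<^sub>m\<^sub>,\<^sub>n f g = \<Theta>\<^sub>m (g \<cdot> f)\<close> and the symmetry of \<open>\<Theta>\<close>. Non-degeneracy amounts to
  bijectivity because Hom-spaces are finite-dimensional. If \<open>f'\<close> and \<open>g'\<close> are the images of
  \<open>f : m \<rightarrow> c \<rhd> n\<close> and \<open>g : c \<rhd> n \<rightarrow> m\<close> under the two balancings, then \<open>f' \<cdot> g'\<close> is the partial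
  trace of \<open>f \<cdot> g\<close>, so that balancedness of \<open>\<eta>\<close> is compatibility of \<open>\<Theta>\<close> with the action.\<close>

section \<open>Non-degenerate pairings\<close>

text \<open>Induction on \<open>J\<close>: the coefficients are found first on the hyperplane where
  the new coordinate \<open>k\<close> vanishes. Any \<open>y\<close> outside that hyperplane spans a
  complement to it in \<open>X\<close>, so a single further coefficient, fixed at \<open>y\<close>,
  extends the formula to all of \<open>X\<close>.\<close>

lemma coordinate_linear_combination:
  fixes X :: "('i \<Rightarrow> complex) set"
  assumes "finite J"
    and "\<And>x y t. x \<in> X \<Longrightarrow> y \<in> X \<Longrightarrow> (\<lambda>i. x i + t * y i) \<in> X"
    and "\<And>x. x \<in> X \<Longrightarrow> \<forall>i\<in>J. x i = 0 \<Longrightarrow> x j = 0"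
  shows "\<exists>a. \<forall>x\<in>X. x j = (\<Sum>i\<in>J. a i * x i)"
  using assms
proof (induction J arbitrary: X rule: finite_induct)
  case empty
  then show ?case by simp
next
  case (insert k J)
  let ?X = "{x \<in> X. x k = 0}"
  have "\<exists>a. \<forall>x\<in>?X. x j = (\<Sum>i\<in>J. a i * x i)"
    by (rule insert.IH) (use insert.prems in auto)
  then obtain a where a: "\<And>x. x \<in> X \<Longrightarrow> x k = 0 \<Longrightarrow> x j = (\<Sum>i\<in>J. a i * x i)"
    by blast
  show ?case
  proof (cases "\<forall>x\<in>X. x k = 0")
    case True
    have "\<forall>x\<in>X. x j = (\<Sum>i\<in>insert k J. a i * x i)"
      using insert.hyps True a by simp
    then show ?thesis by blast
  next
    case False
    then obtain y where y: "y \<in> X" "y k \<noteq> 0" by blast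
    \<comment> \<open>This value is forced: it is the only coefficient at \<open>k\<close> for which
      the formula holds at \<open>y\<close>.\<close>
    define b where "b = (y j - (\<Sum>i\<in>J. a i * y i)) / y k"
    have "x j = (\<Sum>i\<in>insert k J. (a(k := b)) i * x i)" if x: "x \<in> X" for x
    proof -
      \<comment> \<open>\<open>t\<close> is chosen so that \<open>x + t y\<close> lies in the
        hyperplane, where \<open>a\<close> already works.\<close>
      define t where "t = - x k / y k"
      have "x j + t * y j = (\<Sum>i\<in>J. a i * (x i + t * y i))"
        using a[OF insert.prems(1)[OF x y(1), of t]] y(2) by (simp add: t_def)
      also have "\<dots> = (\<Sum>i\<in>J. a i * x i) + t * (\<Sum>i\<in>J. a i * y i)"
        by (simp add: sum_distrib_left sum.distrib algebra_simps)
      finally have "x j = b * x k + (\<Sum>i\<in>J. a i * x i)"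
        using y(2) by (simp add: b_def t_def field_simps)
      moreover have "(\<Sum>i\<in>J. (a(k := b)) i * x i) = (\<Sum>i\<in>J. a i * x i)"
        using insert.hyps by (intro sum.cong) auto
      ultimately show ?thesis using insert.hyps by simp
    qed
    then show ?thesis by blast
  qed
qed

text \<open>The Fredholm alternative for a system of linear equations with values in \<open>X\<close>.\<close>

lemma prescribed_coordinates_or_relation:
  fixes X :: "('i \<Rightarrow> complex) set"
  assumes "finite I" and "X \<noteq> {}"
    and add: "\<And>x y t. x \<in> X \<Longrightarrow> y \<in> X \<Longrightarrow> (\<lambda>i. x i + t * y i) \<in> X"
  shows "(\<exists>x\<in>X. \<forall>i\<in>I. x i = c i) \<or>
    (\<exists>a. (\<forall>x\<in>X. (\<Sum>i\<in>I. a i * x i) = 0) \<and> (\<Sum>i\<in>I. a i * c i) \<noteq> 0)"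
  using assms(1)
proof (induction I rule: finite_induct)
  case empty
  then show ?case using assms(2) by auto
next
  case (insert j J)
  have upd: "(\<Sum>i\<in>insert j J. (a(j := b)) i * x i) = b * x j + (\<Sum>i\<in>J. a i * x i)"
    for a x :: "'i \<Rightarrow> complex" and b
  proof -
    have "(\<Sum>i\<in>J. (a(j := b)) i * x i) = (\<Sum>i\<in>J. a i * x i)"
      using insert.hyps by (intro sum.cong) auto
    then show ?thesis using insert.hyps by simp
  qed
  from insert.IH show ?case
  proof
    assume "\<exists>a. (\<forall>x\<in>X. (\<Sum>i\<in>J. a i * x i) = 0) \<and> (\<Sum>i\<in>J. a i * c i) \<noteq> 0"
    then obtain a where a: "\<forall>x\<in>X. (\<Sum>i\<in>J. a i * x i) = 0" "(\<Sum>i\<in>J. a i * c i) \<noteq> 0"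
      by blast
    \<comment> \<open>An obstruction on \<open>J\<close> remains one on the larger index set when
      \<open>j\<close> receives coefficient 0.\<close>
    show ?thesis
      by (rule disjI2, rule exI[of _ "a(j := 0)"]) (simp only: upd, use a in simp)
  next
    assume "\<exists>x\<in>X. \<forall>i\<in>J. x i = c i"
    then obtain x where x: "x \<in> X" "\<And>i. i \<in> J \<Longrightarrow> x i = c i" by blast
    show ?thesis
    \<comment> \<open>Such a \<open>u\<close> can correct coordinate \<open>j\<close> of
      \<open>x\<close> without disturbing those in \<open>J\<close>. If there is none, coordinate
      \<open>j\<close> depends linearly on the coordinates in \<open>J\<close>, which either makes
      \<open>x\<close> a solution or yields an obstruction.\<close>
    proof (cases "\<exists>u\<in>X. (\<forall>i\<in>J. u i = 0) \<and> u j \<noteq> 0")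
      case True
      then obtain u where u: "u \<in> X" "\<forall>i\<in>J. u i = 0" "u j \<noteq> 0" by blast
      have "\<forall>i\<in>insert j J. x i + (c j - x j) / u j * u i = c i"
        using u x by auto
      then show ?thesis by (intro disjI1 bexI[OF _ add[OF x(1) u(1)]])
    next
      case False
      then obtain a where a: "\<And>x. x \<in> X \<Longrightarrow> x j = (\<Sum>i\<in>J. a i * x i)"
        using coordinate_linear_combination[of J X j] insert.hyps add by blast
      show ?thesis
      proof (cases "x j = c j")
        case True
        then show ?thesis using x by auto
      next
        case False
        \<comment> \<open>The dependence of coordinate \<open>j\<close> on \<open>J\<close>, written
          with coefficient -1 at \<open>j\<close>, is a relation on \<open>X\<close>. Applied to
          \<open>c\<close> it gives \<open>x j - c j\<close>, because \<open>c\<close> and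
          \<open>x\<close> agree on \<open>J\<close>.\<close>
        have "(\<Sum>i\<in>J. a i * c i) = x j"
          using a[OF x(1)] x(2) by simp
        then have "(\<Sum>i\<in>insert j J. (a(j := -1)) i * c i) \<noteq> 0"
          using False unfolding upd by simp
        moreover have "\<forall>x\<in>X. (\<Sum>i\<in>insert j J. (a(j := -1)) i * x i) = 0"
          unfolding upd using a by simp
        ultimately show ?thesis by blast
      qed
    qed
  qed
qed

section \<open>Linear forms on finite-dimensional spaces\<close>

lemma linear_form_zero:
  assumes "module complex_field V" and "linear_form V \<phi>"
  shows "\<phi> \<zero>\<^bsub>V\<^esub> = 0"
proof -
  interpret module complex_field V by fact
  have "\<phi> (\<zero>\<^bsub>V\<^esub> \<oplus>\<^bsub>V\<^esub> \<zero>\<^bsub>V\<^esub>) = \<phi> \<zero>\<^bsub>V\<^esub> + \<phi> \<zero>\<^bsub>V\<^esub>"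
    using assms(2) M.zero_closed unfolding linear_form_def by blast
  then show ?thesis by simp
qed

lemma linear_combination_closed:
  assumes "module complex_field V" and "B \<subseteq> carrier V"
  shows "(\<Oplus>\<^bsub>V\<^esub>b\<in>B. a b \<odot>\<^bsub>V\<^esub> b) \<in> carrier V"
proof -
  interpret module complex_field V by fact
  show ?thesis
    using assms(2) by (intro M.finsum_closed) (auto intro!: smult_closed simp: complex_field_def)
qed

lemma linear_form_linear_combination:
  assumes "module complex_field V" and \<phi>: "linear_form V \<phi>"
    and "finite B" and "B \<subseteq> carrier V"
  shows "\<phi> (\<Oplus>\<^bsub>V\<^esub>b\<in>B. a b \<odot>\<^bsub>V\<^esub> b) = (\<Sum>b\<in>B. a b * \<phi> b)"
  using assms(3,4)
proof (induction B rule: finite_induct)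
  case empty
  interpret module complex_field V by fact
  show ?case
    using linear_form_zero[OF assms(1) \<phi>] by simp
next
  case (insert b B)
  interpret module complex_field V by fact
  have closed: "a v \<odot>\<^bsub>V\<^esub> v \<in> carrier V" if "v \<in> carrier V" for v
    using that by (intro smult_closed) (auto simp: complex_field_def)
  have "(\<Oplus>\<^bsub>V\<^esub>b\<in>insert b B. a b \<odot>\<^bsub>V\<^esub> b) = a b \<odot>\<^bsub>V\<^esub> b \<oplus>\<^bsub>V\<^esub> (\<Oplus>\<^bsub>V\<^esub>b\<in>B. a b \<odot>\<^bsub>V\<^esub> b)"
    using insert closed by (intro M.finsum_insert) auto
  moreover have "(\<Oplus>\<^bsub>V\<^esub>b\<in>B. a b \<odot>\<^bsub>V\<^esub> b) \<in> carrier V"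
    using linear_combination_closed[OF assms(1)] insert.prems by simp
  ultimately show ?case
    using \<phi> insert closed unfolding linear_form_def by simp
qed

text \<open>The Fredholm alternative is applied to the values of the forms \<open>T v\<close> on a
  finite spanning set \<open>B\<close>. Either some \<open>T v\<close> agrees with
  \<open>\<psi>\<close> on \<open>B\<close>, hence everywhere, or a linear relation satisfied by all
  \<open>T v\<close> and violated by \<open>\<psi>\<close> gives a vector that contradicts
  non-degeneracy.\<close>

lemma nondegenerate_pairing_surjective:
  assumes V: "module complex_field V" and W: "module complex_field W"
    and fd: "finite_dimensional W"
    and T: "linear_map V (dual_space W) T"
    and nd: "\<And>w. w \<in> carrier W \<Longrightarrow> \<forall>v \<in> carrier V. T v w = 0 \<Longrightarrow> w = \<zero>\<^bsub>W\<^esub>"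
    and \<psi>: "linear_form W \<psi>"
  shows "\<psi> \<in> T ` carrier V"
proof -
  interpret V: module complex_field V by fact
  obtain B where B: "finite B" "B \<subseteq> carrier W"
    and span: "\<And>w. w \<in> carrier W \<Longrightarrow> \<exists>a. w = (\<Oplus>\<^bsub>W\<^esub>b\<in>B. a b \<odot>\<^bsub>W\<^esub> b)"
    using fd unfolding finite_dimensional_def by blast
  have form: "linear_form W (T v)" if "v \<in> carrier V" for v
    using T that by (auto simp: linear_map_def dual_space_def Pi_iff)
  \<comment> \<open>Off \<open>carrier W\<close> the form \<open>T v\<close> has the value
    \<open>undefined\<close>, which sums do not respect. Replacing it by 0 makes the family closed
    under \<open>x + t y\<close> at every index.\<close>
  define E where "E v w = (if w \<in> carrier W then T v w else 0)" for v w
  have "(\<lambda>i. x i + t * y i) \<in> E ` carrier V"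
    if xy: "x \<in> E ` carrier V" "y \<in> E ` carrier V" for x y t
  proof -
    from xy obtain u v where u: "u \<in> carrier V" "x = E u" and v: "v \<in> carrier V" "y = E v"
      by blast
    have tv: "t \<odot>\<^bsub>V\<^esub> v \<in> carrier V"
      using v(1) by (intro V.smult_closed) (auto simp: complex_field_def)
    have "T (u \<oplus>\<^bsub>V\<^esub> t \<odot>\<^bsub>V\<^esub> v) = (\<lambda>w \<in> carrier W. T u w + (\<lambda>w \<in> carrier W. t * T v w) w)"
      using T u v tv by (simp add: linear_map_def dual_space_def)
    then have "E (u \<oplus>\<^bsub>V\<^esub> t \<odot>\<^bsub>V\<^esub> v) = (\<lambda>i. x i + t * y i)"
      by (auto simp: E_def u v fun_eq_iff)
    then show ?thesis using u v tv by (metis V.M.a_closed imageI)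
  qed
  moreover have "E ` carrier V \<noteq> {}" using V.M.zero_closed by blast
  ultimately have "(\<exists>x\<in>E ` carrier V. \<forall>b\<in>B. x b = \<psi> b) \<or>
    (\<exists>a. (\<forall>x\<in>E ` carrier V. (\<Sum>b\<in>B. a b * x b) = 0) \<and> (\<Sum>b\<in>B. a b * \<psi> b) \<noteq> 0)"
    by (intro prescribed_coordinates_or_relation[OF B(1)])
  then consider
      x where "x \<in> E ` carrier V" "\<forall>b\<in>B. x b = \<psi> b"
    | a where "\<forall>x\<in>E ` carrier V. (\<Sum>b\<in>B. a b * x b) = 0" "(\<Sum>b\<in>B. a b * \<psi> b) \<noteq> 0"
    by blast
  then show ?thesis
  proof cases
    case 1
    then obtain v where v: "v \<in> carrier V" and vb: "\<And>b. b \<in> B \<Longrightarrow> T v b = \<psi> b"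
    proof -
      from 1(1) obtain v where v: "v \<in> carrier V" "x = E v" by blast
      show thesis
      proof (rule that[OF v(1)])
        fix b assume b: "b \<in> B"
        then have "b \<in> carrier W" using B(2) by blast
        then show "T v b = \<psi> b" using bspec[OF 1(2) b] by (simp add: E_def v(2))
      qed
    qed
    have "T v w = \<psi> w" if w: "w \<in> carrier W" for w
    proof -
      obtain a where "w = (\<Oplus>\<^bsub>W\<^esub>b\<in>B. a b \<odot>\<^bsub>W\<^esub> b)" using span[OF w] by blast
      then show ?thesis
        using linear_form_linear_combination[OF W form[OF v] B]
          linear_form_linear_combination[OF W \<psi> B] vb by simp
    qed
    then have "T v = \<psi>"
      using form[OF v] \<psi> by (intro extensionalityI[of _ "carrier W"]) (auto simp: linear_form_def)
    then show ?thesis using v by blast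
  next
    case 2
    \<comment> \<open>The relation, read as a vector: every \<open>T v\<close> kills it, so it is
      zero, although \<open>\<psi>\<close> does not vanish on it.\<close>
    let ?w = "\<Oplus>\<^bsub>W\<^esub>b\<in>B. a b \<odot>\<^bsub>W\<^esub> b"
    have "T v ?w = 0" if v: "v \<in> carrier V" for v
    proof -
      have "T v ?w = (\<Sum>b\<in>B. a b * T v b)"
        by (rule linear_form_linear_combination[OF W form[OF v] B])
      also have "\<dots> = (\<Sum>b\<in>B. a b * E v b)"
        using B(2) by (intro sum.cong) (auto simp: E_def)
      finally show ?thesis using 2(1) v by simp
    qed
    then have "?w = \<zero>\<^bsub>W\<^esub>"
      using nd linear_combination_closed[OF W B(2)] by blast
    then show ?thesis
      using linear_form_linear_combination[OF W \<psi> B, of a] linear_form_zero[OF W \<psi>] 2(2) by simp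
  qed
qed

lemma linear_map_injI:
  assumes V: "module complex_field V"
    and T: "linear_map V (dual_space W) T"
    and nd: "\<And>v. v \<in> carrier V \<Longrightarrow> \<forall>w \<in> carrier W. T v w = 0 \<Longrightarrow> v = \<zero>\<^bsub>V\<^esub>"
  shows "inj_on T (carrier V)"
proof (rule inj_onI)
  interpret V: module complex_field V by fact
  fix u v assume u: "u \<in> carrier V" and v: "v \<in> carrier V" and eq: "T u = T v"
  \<comment> \<open>The difference is formed with the scalar -1 because \<open>linear_map\<close>
    speaks of sums and scalar multiples only.\<close>
  let ?d = "u \<oplus>\<^bsub>V\<^esub> (-1) \<odot>\<^bsub>V\<^esub> v"
  have sc: "x \<odot>\<^bsub>V\<^esub> v \<in> carrier V" for x
    using v by (intro V.smult_closed) (auto simp: complex_field_def)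
  have "T ?d w = 0" if "w \<in> carrier W" for w
    using T u v sc eq that by (simp add: linear_map_def dual_space_def)
  then have d: "?d = \<zero>\<^bsub>V\<^esub>" using nd u sc by simp
  have "(1 + -1) \<odot>\<^bsub>V\<^esub> v = 1 \<odot>\<^bsub>V\<^esub> v \<oplus>\<^bsub>V\<^esub> (-1) \<odot>\<^bsub>V\<^esub> v"
    using V.smult_l_distr[of 1 "-1" v] v by (simp add: complex_field_def)
  moreover have "1 \<odot>\<^bsub>V\<^esub> v = v"
    using V.smult_one[OF v] by (simp add: complex_field_def)
  moreover have "0 \<odot>\<^bsub>V\<^esub> v = \<zero>\<^bsub>V\<^esub>"
    using V.smult_l_null[OF v] by (simp add: complex_field_def)
  ultimately have "v \<oplus>\<^bsub>V\<^esub> (-1) \<odot>\<^bsub>V\<^esub> v = \<zero>\<^bsub>V\<^esub>" by simp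
  with d show "u = v" using V.M.add.right_cancel[of "(-1) \<odot>\<^bsub>V\<^esub> v" u v] u v sc by simp
qed


section \<open>Morphisms of module categories\<close>

text \<open>\<open>inv_mor\<close> is a definite description, so the uniqueness of two-sided
  inverses has to be established before anything can be said about its value.\<close>

lemma (in linear_category) inv_mor_closed:
  assumes "iso_mor C x y f"
  shows "inv_mor C x y f \<in> Mor C y x"
proof -
  obtain g where g: "inverse_mor C x y f g"
    using assms unfolding iso_mor_def by blast
  have "h = g" if h: "inverse_mor C x y f h" for h
  proof -
    have "h = h \<cdot> (f \<cdot> g)" using g h cmp_idm[of h y x] by (simp add: inverse_mor_def)
    also have "\<dots> = h \<cdot> f \<cdot> g" using g h cmp_assoc[of g y x f y h x] by (simp add: inverse_mor_def)
    also have "\<dots> = g" using g h idm_cmp[of g y x] by (simp add: inverse_mor_def)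
    finally show ?thesis .
  qed
  with g have "inv_mor C x y f = g"
    unfolding inv_mor_def by (rule the_equality)
  then show ?thesis using g by (simp add: inverse_mor_def)
qed

lemma (in linear_category) iso_mor_closed: "iso_mor C x y f \<Longrightarrow> f \<in> Mor C x y"
  by (auto simp: iso_mor_def inverse_mor_def)

section \<open>Duality morphisms of a fusion category\<close>

context fusion_category
begin

lemmas structure_closed =
  idm_closed asc_iso[THEN iso_mor_closed] lun_iso[THEN iso_mor_closed] run_iso[THEN iso_mor_closed]
  asc_iso[THEN inv_mor_closed] lun_iso[THEN inv_mor_closed] run_iso[THEN inv_mor_closed]

lemma ev_closed: "ev C x \<in> Mor C (rd C x \<boxtimes> x) (unt C)"
  and coev_closed: "coev C x \<in> Mor C (unt C) (x \<boxtimes> rd C x)"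
  and ev'_closed: "ev' C x \<in> Mor C (x \<boxtimes> ld C x) (unt C)"
  and coev'_closed: "coev' C x \<in> Mor C (unt C) (ld C x \<boxtimes> x)"
  using right_dual[of x] left_dual[of x] by (simp_all add: duality_def)

lemma to_dual_closed:
  assumes "e \<in> Mor C (y \<boxtimes> x) (unt C)"
  shows "to_dual C y x e \<in> Mor C y (rd C x)"
  unfolding to_dual_def
  by (rule cmp_closed tnsh_closed structure_closed coev_closed assms)+

lemma rd_mor_closed:
  assumes "f \<in> Mor C x y"
  shows "rd_mor C x y f \<in> Mor C (rd C y) (rd C x)"
  unfolding rd_mor_def
  by (intro to_dual_closed cmp_closed[OF tnsh_closed[OF idm_closed assms] ev_closed])

lemma piv_ld_closed:
  assumes "pivotal_structure C a"
  shows "piv_ld C a c \<in> Mor C (ld C c) (rd C c)"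
  unfolding piv_ld_def
proof (rule cmp_closed)
  show "a (ld C c) \<in> Mor C (ld C c) (rdd C (ld C c))"
    using assms unfolding pivotal_structure_def by (blast intro: iso_mor_closed)
qed (intro rd_mor_closed to_dual_closed ev'_closed)

end

section \<open>Balancings and the partial trace\<close>

locale pivotal_module_category =
  fusion_category C + module_category C M
  for C :: "('o, 'h, 'z) rigid_cat_scheme" and M :: "('n, 'k, 'o, 'h, 'y) mod_cat_scheme" +
  fixes a :: "'o \<Rightarrow> 'h"
  assumes pivotal: "pivotal_structure C a"
begin

lemma mod_ev_closed: "mod_ev C M c m \<in> Mor M (rd C c \<rhd>\<^bsub>M\<^esub> (c \<rhd>\<^bsub>M\<^esub> m)) m"
  unfolding mod_ev_def
  by (rule M.cmp_closed acth_closed ev_closed M.idm_closed mun_iso[THEN M.iso_mor_closed]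
      masc_iso[THEN M.inv_mor_closed])+

lemma mod_coev'_closed: "mod_coev' C M c m \<in> Mor M m (ld C c \<rhd>\<^bsub>M\<^esub> (c \<rhd>\<^bsub>M\<^esub> m))"
  unfolding mod_coev'_def
  by (rule M.cmp_closed acth_closed coev'_closed M.idm_closed masc_iso[THEN M.iso_mor_closed]
      mun_iso[THEN M.inv_mor_closed])+

lemma Hom_balancing_closed:
  assumes "f \<in> Mor M m (c \<rhd>\<^bsub>M\<^esub> n)"
  shows "Hom_balancing C M c n f \<in> Mor M (rd C c \<rhd>\<^bsub>M\<^esub> m) n"
  unfolding Hom_balancing_def
  by (rule M.cmp_closed[OF acth_closed[OF idm_closed assms] mod_ev_closed])

lemma Hom_cobalancing_closed:
  assumes "g \<in> Mor M (c \<rhd>\<^bsub>M\<^esub> n) m"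
  shows "Hom_cobalancing C a M c n g \<in> Mor M n (rd C c \<rhd>\<^bsub>M\<^esub> m)"
  unfolding Hom_cobalancing_def
  by (rule M.cmp_closed[OF mod_coev'_closed acth_closed[OF piv_ld_closed[OF pivotal] assms]])

text \<open>Functoriality of the action fuses the two middle factors, the identity acting with
  \<open>f\<close> and \<open>piv_ld C a c\<close> acting with \<open>g\<close>, into
  \<open>piv_ld C a c\<close> acting with the composite. The outer factors \<open>mod_ev\<close> and
  \<open>mod_coev'\<close> are already those of the partial trace.\<close>

lemma balancing_cmp_cobalancing:
  assumes f: "f \<in> Mor M m (c \<rhd>\<^bsub>M\<^esub> n)" and g: "g \<in> Mor M (c \<rhd>\<^bsub>M\<^esub> n) m"
  shows "Hom_balancing C M c n f \<cdot>\<^bsub>M\<^esub> Hom_cobalancing C a M c n g =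
    partial_trace C a M c n (f \<cdot>\<^bsub>M\<^esub> g)"
proof -
  let ?e = "mod_ev C M c n" and ?k = "mod_coev' C M c n" and ?p = "piv_ld C a c"
  let ?f = "idm C (rd C c) \<rhd>\<^sub>h\<^bsub>M\<^esub> f" and ?g = "?p \<rhd>\<^sub>h\<^bsub>M\<^esub> g"
  note p = piv_ld_closed[OF pivotal, of c]
  note F = acth_closed[OF idm_closed[of "rd C c"] f]
  note G = acth_closed[OF p g]
  have "?f \<cdot>\<^bsub>M\<^esub> ?g = ?p \<rhd>\<^sub>h\<^bsub>M\<^esub> (f \<cdot>\<^bsub>M\<^esub> g)"
    using acth_cmp[OF p idm_closed g f] idm_cmp[OF p] by simp
  moreover have "(?e \<cdot>\<^bsub>M\<^esub> ?f) \<cdot>\<^bsub>M\<^esub> (?g \<cdot>\<^bsub>M\<^esub> ?k) = ?e \<cdot>\<^bsub>M\<^esub> (?f \<cdot>\<^bsub>M\<^esub> ?g) \<cdot>\<^bsub>M\<^esub> ?k"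
    using M.cmp_assoc[OF mod_coev'_closed G M.cmp_closed[OF F mod_ev_closed]]
      M.cmp_assoc[OF G F mod_ev_closed] by simp
  ultimately show ?thesis
    by (simp add: Hom_balancing_def Hom_cobalancing_def partial_trace_def)
qed


section \<open>Traces and natural isomorphisms\<close>

text \<open>Both arguments are restricted: the outer restriction makes each component extensional,
  the inner one makes its values extensional linear forms. This is what allows
  \<open>pairing_trace\<close> to be a strict inverse.\<close>

definition trace_pairing :: "('n \<Rightarrow> 'k \<Rightarrow> complex) \<Rightarrow> 'n \<Rightarrow> 'n \<Rightarrow> 'k \<Rightarrow> 'k \<Rightarrow> complex" where
  "trace_pairing \<Theta> m n = (\<lambda>f \<in> Mor M m n. \<lambda>g \<in> Mor M n m. \<Theta> m (g \<cdot>\<^bsub>M\<^esub> f))"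

definition pairing_trace :: "('n \<Rightarrow> 'n \<Rightarrow> 'k \<Rightarrow> 'k \<Rightarrow> complex) \<Rightarrow> 'n \<Rightarrow> 'k \<Rightarrow> complex" where
  "pairing_trace \<eta> m = \<eta> m m (idm M m)"

lemma trace_pairing_apply:
  "\<lbrakk>f \<in> Mor M m n; g \<in> Mor M n m\<rbrakk> \<Longrightarrow> trace_pairing \<Theta> m n f g = \<Theta> m (g \<cdot>\<^bsub>M\<^esub> f)"
  by (simp add: trace_pairing_def)

text \<open>Composing with the identity returns \<open>\<Theta> m\<close> restricted to
  endomorphisms, and the linear form \<open>\<Theta> m\<close> is extensional.\<close>

lemma pairing_trace_trace_pairing:
  assumes "module_trace C a M \<Theta>"
  shows "pairing_trace (trace_pairing \<Theta>) = \<Theta>"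
proof
  fix m
  have "\<Theta> m \<in> extensional (Mor M m m)"
    using assms by (simp add: module_trace_def linear_form_def)
  moreover have "pairing_trace (trace_pairing \<Theta>) m = restrict (\<Theta> m) (Mor M m m)"
    by (simp add: pairing_trace_def trace_pairing_def M.idm_closed M.cmp_idm restrict_def fun_eq_iff)
  ultimately show "pairing_trace (trace_pairing \<Theta>) m = \<Theta> m"
    by (simp add: extensional_restrict)
qed

section \<open>From module traces to balanced natural isomorphisms\<close>

lemma linear_map_trace_pairing:
  assumes lin: "linear_form (Hom M m m) (\<Theta> m)"
  shows "linear_map (Hom M m n) (dual_space (Hom M n m)) (trace_pairing \<Theta> m n)"
proof -
  interpret mn: module complex_field "Hom M m n" by (rule M.Hom_module)
  interpret nm: module complex_field "Hom M n m" by (rule M.Hom_module)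
  have smult_mn: "x \<odot>\<^bsub>Hom M m n\<^esub> f \<in> Mor M m n" if "f \<in> Mor M m n" for x f
    using that by (intro mn.smult_closed) (auto simp: complex_field_def)
  have smult_nm: "x \<odot>\<^bsub>Hom M n m\<^esub> f \<in> Mor M n m" if "f \<in> Mor M n m" for x f
    using that by (intro nm.smult_closed) (auto simp: complex_field_def)
  have add: "\<Theta> m (x \<oplus>\<^bsub>Hom M m m\<^esub> y) = \<Theta> m x + \<Theta> m y"
    if "x \<in> Mor M m m" "y \<in> Mor M m m" for x y
    using lin that by (simp add: linear_form_def)
  have smult: "\<Theta> m (t \<odot>\<^bsub>Hom M m m\<^esub> x) = t * \<Theta> m x" if "x \<in> Mor M m m" for t x
    using lin that by (simp add: linear_form_def)
  have "linear_form (Hom M n m) (trace_pairing \<Theta> m n f)" if f: "f \<in> Mor M m n" for f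
    unfolding linear_form_def
    by (auto simp: trace_pairing_def f smult_nm M.cmp_add_left[OF f] M.cmp_smult_left[OF f] M.cmp_closed[OF f]
        intro!: add smult)
  then show ?thesis
    unfolding linear_map_def dual_space_def
    by (auto simp: fun_eq_iff restrict_def trace_pairing_def smult_mn M.cmp_add_right
        M.cmp_smult_right M.cmp_closed add smult)
qed

text \<open>Non-degeneracy in \<open>f\<close> gives injectivity; non-degeneracy in
  \<open>g\<close>, together with finite dimension, gives surjectivity. Naturality is cyclicity of
  the trace.\<close>

lemma natural_iso_trace_pairing:
  assumes tr: "module_trace C a M \<Theta>"
  shows "natural_iso_Hom_dual M (trace_pairing \<Theta>)"
proof -
  have lin: "linear_map (Hom M m n) (dual_space (Hom M n m)) (trace_pairing \<Theta> m n)" for m n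
    using tr by (intro linear_map_trace_pairing) (simp add: module_trace_def)
  have sym: "\<Theta> m (g \<cdot>\<^bsub>M\<^esub> f) = \<Theta> n (f \<cdot>\<^bsub>M\<^esub> g)" if "f \<in> Mor M m n" "g \<in> Mor M n m" for m n f g
    using tr that unfolding module_trace_def by blast
  have nondeg1: "f = \<zero>\<^bsub>Hom M m n\<^esub>"
    if f: "f \<in> Mor M m n" and z: "\<forall>g \<in> Mor M n m. trace_pairing \<Theta> m n f g = 0" for m n f
  proof -
    have "\<forall>g \<in> Mor M n m. \<Theta> m (g \<cdot>\<^bsub>M\<^esub> f) = 0" using z by (simp add: trace_pairing_apply[OF f])
    then show ?thesis using tr f unfolding module_trace_def by blast
  qed
  have nondeg2: "g = \<zero>\<^bsub>Hom M n m\<^esub>"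
    if g: "g \<in> Mor M n m" and z: "\<forall>f \<in> Mor M m n. trace_pairing \<Theta> m n f g = 0" for m n g
  proof -
    have "\<forall>f \<in> Mor M m n. \<Theta> m (g \<cdot>\<^bsub>M\<^esub> f) = 0" using z by (simp add: trace_pairing_apply[OF _ g])
    then show ?thesis using tr g unfolding module_trace_def by blast
  qed
  have bij: "bij_betw (trace_pairing \<Theta> m n) (Mor M m n) (carrier (dual_space (Hom M n m)))" for m n
    unfolding bij_betw_def
  proof
    show "inj_on (trace_pairing \<Theta> m n) (Mor M m n)"
      by (rule linear_map_injI[OF M.Hom_module lin nondeg1])
    show "trace_pairing \<Theta> m n ` Mor M m n = carrier (dual_space (Hom M n m))"
    proof
      show "trace_pairing \<Theta> m n ` Mor M m n \<subseteq> carrier (dual_space (Hom M n m))"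
        using lin[of m n] by (auto simp: linear_map_def)
      show "carrier (dual_space (Hom M n m)) \<subseteq> trace_pairing \<Theta> m n ` Mor M m n"
        using nondegenerate_pairing_surjective[OF M.Hom_module M.Hom_module
            M.finite_dimensional_Hom lin nondeg2]
        by (auto simp: dual_space_def)
    qed
  qed
  have nat: "trace_pairing \<Theta> m' n' (Hom_map M v u f) = Hom_dual_map M m' n' v u (trace_pairing \<Theta> m n f)"
    if v: "v \<in> Mor M m' m" and u: "u \<in> Mor M n n'" and f: "f \<in> Mor M m n" for m n m' n' v u f
  proof -
    have fv: "f \<cdot>\<^bsub>M\<^esub> v \<in> Mor M m' n" and uf: "u \<cdot>\<^bsub>M\<^esub> f \<in> Mor M m n'"
      using v u f by (auto intro: M.cmp_closed)
    have ufv: "u \<cdot>\<^bsub>M\<^esub> f \<cdot>\<^bsub>M\<^esub> v \<in> Mor M m' n'" using v uf by (rule M.cmp_closed)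
    have "\<Theta> m' (g \<cdot>\<^bsub>M\<^esub> (u \<cdot>\<^bsub>M\<^esub> f \<cdot>\<^bsub>M\<^esub> v)) = trace_pairing \<Theta> m n f (v \<cdot>\<^bsub>M\<^esub> g \<cdot>\<^bsub>M\<^esub> u)"
      if g: "g \<in> Mor M n' m'" for g
    proof -
      have gu: "g \<cdot>\<^bsub>M\<^esub> u \<in> Mor M n m'" and vg: "v \<cdot>\<^bsub>M\<^esub> g \<in> Mor M n' m"
        using g u v by (auto intro: M.cmp_closed)
      have guf: "g \<cdot>\<^bsub>M\<^esub> u \<cdot>\<^bsub>M\<^esub> f \<in> Mor M m m'" using f gu by (rule M.cmp_closed)
      have vgu: "v \<cdot>\<^bsub>M\<^esub> g \<cdot>\<^bsub>M\<^esub> u \<in> Mor M n m" using u vg by (rule M.cmp_closed)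
      have "g \<cdot>\<^bsub>M\<^esub> (u \<cdot>\<^bsub>M\<^esub> f \<cdot>\<^bsub>M\<^esub> v) = g \<cdot>\<^bsub>M\<^esub> u \<cdot>\<^bsub>M\<^esub> f \<cdot>\<^bsub>M\<^esub> v"
        using M.cmp_assoc[OF v uf g] M.cmp_assoc[OF f u g] by simp
      \<comment> \<open>Symmetry carries \<open>v\<close> from the right end of the composite to the
        left, changing the trace from \<open>m'\<close> to \<open>m\<close>.\<close>
      then have "\<Theta> m' (g \<cdot>\<^bsub>M\<^esub> (u \<cdot>\<^bsub>M\<^esub> f \<cdot>\<^bsub>M\<^esub> v)) = \<Theta> m (v \<cdot>\<^bsub>M\<^esub> (g \<cdot>\<^bsub>M\<^esub> u \<cdot>\<^bsub>M\<^esub> f))"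
        using sym[OF v guf] by simp
      moreover have "v \<cdot>\<^bsub>M\<^esub> (g \<cdot>\<^bsub>M\<^esub> u \<cdot>\<^bsub>M\<^esub> f) = v \<cdot>\<^bsub>M\<^esub> g \<cdot>\<^bsub>M\<^esub> u \<cdot>\<^bsub>M\<^esub> f"
        using M.cmp_assoc[OF f gu v] M.cmp_assoc[OF u g v] by simp
      ultimately show ?thesis using f vgu by (simp add: trace_pairing_apply)
    qed
    then show ?thesis
      using ufv by (simp add: Hom_map_def Hom_dual_map_def trace_pairing_def restrict_def fun_eq_iff)
  qed
  have "trace_pairing \<Theta> m n \<in> extensional (Mor M m n)" for m n
    by (simp add: trace_pairing_def)
  then show ?thesis
    unfolding natural_iso_Hom_dual_def using lin bij nat by blast
qed

text \<open>Symmetry moves the trace to \<open>c \<rhd> n\<close>, compatibility reduces it to a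
  partial trace at \<open>n\<close>, and that partial trace factors through the two balancings. A
  second use of symmetry puts these factors in the order required by the pairing.\<close>

lemma balanced_trace_pairing:
  assumes tr: "module_trace C a M \<Theta>"
  shows "balanced C a M (trace_pairing \<Theta>)"
  unfolding balanced_def
proof (intro allI ballI)
  fix c m n f assume f: "f \<in> Mor M m (c \<rhd>\<^bsub>M\<^esub> n)"
  have sym: "\<Theta> m (g \<cdot>\<^bsub>M\<^esub> f) = \<Theta> n (f \<cdot>\<^bsub>M\<^esub> g)" if "f \<in> Mor M m n" "g \<in> Mor M n m" for m n f g
    using tr that unfolding module_trace_def by blast
  let ?f = "Hom_balancing C M c n f" and ?g = "Hom_cobalancing C a M c n"
  note F = Hom_balancing_closed[OF f]
  have "\<Theta> m (g \<cdot>\<^bsub>M\<^esub> f) = trace_pairing \<Theta> (rd C c \<rhd>\<^bsub>M\<^esub> m) n ?f (?g g)"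
    if g: "g \<in> Mor M (c \<rhd>\<^bsub>M\<^esub> n) m" for g
  proof -
    note G = Hom_cobalancing_closed[OF g]
    have "\<Theta> m (g \<cdot>\<^bsub>M\<^esub> f) = \<Theta> (c \<rhd>\<^bsub>M\<^esub> n) (f \<cdot>\<^bsub>M\<^esub> g)" by (rule sym[OF f g])
    also have "\<dots> = \<Theta> n (partial_trace C a M c n (f \<cdot>\<^bsub>M\<^esub> g))"
      using tr M.cmp_closed[OF g f] unfolding module_trace_def by blast
    also have "\<dots> = \<Theta> n (?f \<cdot>\<^bsub>M\<^esub> ?g g)" by (simp add: balancing_cmp_cobalancing[OF f g])
    also have "\<dots> = \<Theta> (rd C c \<rhd>\<^bsub>M\<^esub> m) (?g g \<cdot>\<^bsub>M\<^esub> ?f)" by (rule sym[OF F G, symmetric])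
    finally show ?thesis using F G by (simp add: trace_pairing_apply)
  qed
  then show "trace_pairing \<Theta> m (c \<rhd>\<^bsub>M\<^esub> n) f =
      Hom_dual_balancing C a M c m n (trace_pairing \<Theta> (rd C c \<rhd>\<^bsub>M\<^esub> m) n ?f)"
    using f by (simp add: Hom_dual_balancing_def trace_pairing_def restrict_def fun_eq_iff)
qed

section \<open>From balanced natural isomorphisms to module traces\<close>

text \<open>A Yoneda argument: \<open>f\<close> arises from \<open>idm M m\<close> by
  postcomposition with \<open>f\<close> and from \<open>idm M n\<close> by precomposition with
  \<open>f\<close>, so naturality computes \<open>\<eta> m n f\<close> from either identity.
  Comparing the two results yields symmetry of the trace.\<close>

lemma pairing_trace_cmp:
  assumes nat: "natural_iso_Hom_dual M \<eta>" and f: "f \<in> Mor M m n" and g: "g \<in> Mor M n m"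
  shows "\<eta> m n f g = pairing_trace \<eta> m (g \<cdot>\<^bsub>M\<^esub> f)"
    and "\<eta> m n f g = pairing_trace \<eta> n (f \<cdot>\<^bsub>M\<^esub> g)"
proof -
  have nat': "\<eta> m' n' (Hom_map M v u f) = Hom_dual_map M m' n' v u (\<eta> m n f)"
    if "v \<in> Mor M m' m" "u \<in> Mor M n n'" "f \<in> Mor M m n" for m n m' n' v u f
    using nat that unfolding natural_iso_Hom_dual_def by blast
  have "Hom_map M (idm M m) f (idm M m) = f" "Hom_map M f (idm M n) (idm M n) = f"
    using f M.cmp_idm[OF M.idm_closed[of n]] by (simp_all add: Hom_map_def M.cmp_idm M.idm_cmp M.idm_closed)
  then have eq: "\<eta> m n f = Hom_dual_map M m n (idm M m) f (\<eta> m m (idm M m))"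
      "\<eta> m n f = Hom_dual_map M m n f (idm M n) (\<eta> n n (idm M n))"
    using nat'[OF M.idm_closed f M.idm_closed] nat'[OF f M.idm_closed M.idm_closed] by simp_all
  have "\<eta> m n f g = \<eta> m m (idm M m) (idm M m \<cdot>\<^bsub>M\<^esub> g \<cdot>\<^bsub>M\<^esub> f)"
    and "\<eta> m n f g = \<eta> n n (idm M n) (f \<cdot>\<^bsub>M\<^esub> g \<cdot>\<^bsub>M\<^esub> idm M n)"
    using fun_cong[OF eq(1), of g] fun_cong[OF eq(2), of g] g
    by (simp_all only: Hom_dual_map_def restrict_apply')
  then show "\<eta> m n f g = pairing_trace \<eta> m (g \<cdot>\<^bsub>M\<^esub> f)"
    and "\<eta> m n f g = pairing_trace \<eta> n (f \<cdot>\<^bsub>M\<^esub> g)"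
    by (simp_all add: pairing_trace_def M.idm_cmp[OF g] M.cmp_idm[OF M.cmp_closed[OF g f]])
qed

lemma linear_form_natural_iso:
  assumes "natural_iso_Hom_dual M \<eta>" and "f \<in> Mor M m n"
  shows "linear_form (Hom M n m) (\<eta> m n f)"
proof -
  have "linear_map (Hom M m n) (dual_space (Hom M n m)) (\<eta> m n)"
    using assms(1) unfolding natural_iso_Hom_dual_def by blast
  then show ?thesis using assms(2) by (auto simp: linear_map_def dual_space_def Pi_iff)
qed

text \<open>On morphisms this is naturality. Elsewhere both sides are \<open>undefined\<close>: in
  \<open>f\<close> because the components of \<open>\<eta>\<close> are extensional, in
  \<open>g\<close> because linear forms are.\<close>

lemma trace_pairing_pairing_trace:
  assumes nat: "natural_iso_Hom_dual M \<eta>"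
  shows "trace_pairing (pairing_trace \<eta>) = \<eta>"
proof (intro ext)
  fix m n f g
  have ext: "\<eta> m n \<in> extensional (Mor M m n)"
    using nat unfolding natural_iso_Hom_dual_def by blast
  show "trace_pairing (pairing_trace \<eta>) m n f g = \<eta> m n f g"
  proof (cases "f \<in> Mor M m n")
    case f: True
    have ext': "\<eta> m n f \<in> extensional (Mor M n m)"
      using linear_form_natural_iso[OF nat f] by (simp add: linear_form_def)
    show ?thesis
    proof (cases "g \<in> Mor M n m")
      case True
      then show ?thesis
        using f pairing_trace_cmp(1)[OF nat f] by (simp add: trace_pairing_apply)
    next
      case False
      then show ?thesis
        using f extensional_arb[OF ext'] by (simp add: trace_pairing_def)
    qed
  next
    case False
    then show ?thesis
      using extensional_arb[OF ext] by (simp add: trace_pairing_def)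
  qed
qed

text \<open>Injectivity of \<open>\<eta>\<close> gives non-degeneracy on one side, and symmetry
  transfers it to the other. Compatibility is balancedness tested against an identity
  morphism.\<close>

lemma module_trace_pairing_trace:
  assumes nat: "natural_iso_Hom_dual M \<eta>" and bal: "balanced C a M \<eta>"
  shows "module_trace C a M (pairing_trace \<eta>)"
proof -
  let ?\<Theta> = "pairing_trace \<eta>"
  have form: "linear_form (Hom M m m) (?\<Theta> m)" for m
    unfolding pairing_trace_def by (rule linear_form_natural_iso[OF nat M.idm_closed])
  have sym: "?\<Theta> m (g \<cdot>\<^bsub>M\<^esub> f) = ?\<Theta> n (f \<cdot>\<^bsub>M\<^esub> g)" if "f \<in> Mor M m n" "g \<in> Mor M n m" for m n f g
    using pairing_trace_cmp[OF nat that] by simp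
  have nondeg: "f = \<zero>\<^bsub>Hom M m n\<^esub>"
    if f: "f \<in> Mor M m n" and z: "\<And>g. g \<in> Mor M n m \<Longrightarrow> ?\<Theta> m (g \<cdot>\<^bsub>M\<^esub> f) = 0" for m n f
  proof -
    interpret mn: module complex_field "Hom M m n" by (rule M.Hom_module)
    let ?z = "\<zero>\<^bsub>Hom M m n\<^esub>"
    have inj: "inj_on (\<eta> m n) (Mor M m n)"
      and lin: "linear_map (Hom M m n) (dual_space (Hom M n m)) (\<eta> m n)"
      using nat unfolding natural_iso_Hom_dual_def bij_betw_def by blast+
    \<comment> \<open>Writing zero as a scalar multiple of \<open>f\<close> lets linearity determine
      \<open>\<eta> m n ?z\<close>: it is the zero form, which is also what
      \<open>\<eta> m n f\<close> turns out to be.\<close>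
    have zero: "0 \<odot>\<^bsub>Hom M m n\<^esub> f = ?z"
      using mn.smult_l_null[OF f] by (simp add: complex_field_def)
    have "\<eta> m n (0 \<odot>\<^bsub>Hom M m n\<^esub> f) = 0 \<odot>\<^bsub>dual_space (Hom M n m)\<^esub> \<eta> m n f"
      using lin f unfolding linear_map_def by blast
    then have "\<eta> m n ?z = (\<lambda>g \<in> Mor M n m. 0 * \<eta> m n f g)"
      unfolding zero by (simp add: dual_space_def)
    moreover have "\<eta> m n f = (\<lambda>g \<in> Mor M n m. 0)"
      using linear_form_natural_iso[OF nat f] pairing_trace_cmp(1)[OF nat f] z
      by (intro extensionalityI[of _ "Mor M n m"]) (auto simp: linear_form_def)
    ultimately have "\<eta> m n f = \<eta> m n ?z" by simp
    then show ?thesis using inj f mn.M.zero_closed by (simp add: inj_on_eq_iff)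
  qed
  have nondeg': "g = \<zero>\<^bsub>Hom M n m\<^esub>"
    if g: "g \<in> Mor M n m" and z: "\<forall>f \<in> Mor M m n. ?\<Theta> m (g \<cdot>\<^bsub>M\<^esub> f) = 0" for m n g
    \<comment> \<open>The preceding fact is used with \<open>m\<close> and \<open>n\<close>
      exchanged.\<close>
    by (rule nondeg[OF g]) (use sym[OF _ g] z in simp)
  have compat: "?\<Theta> (c \<rhd>\<^bsub>M\<^esub> m) f = ?\<Theta> m (partial_trace C a M c m f)"
    if f: "f \<in> Mor M (c \<rhd>\<^bsub>M\<^esub> m) (c \<rhd>\<^bsub>M\<^esub> m)" for c m f
  proof -
    let ?x = "c \<rhd>\<^bsub>M\<^esub> m" and ?f = "Hom_balancing C M c m f"
    \<comment> \<open>With the identity of \<open>c \<rhd> m\<close> as second argument, the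
      composite of the two balancings is the partial trace of \<open>f\<close> itself.\<close>
    let ?g = "Hom_cobalancing C a M c m (idm M (c \<rhd>\<^bsub>M\<^esub> m))"
    have "\<eta> ?x ?x f = Hom_dual_balancing C a M c ?x m (\<eta> (rd C c \<rhd>\<^bsub>M\<^esub> ?x) m ?f)"
      using bal f unfolding balanced_def by blast
    then have "\<eta> ?x ?x f (idm M ?x) = \<eta> (rd C c \<rhd>\<^bsub>M\<^esub> ?x) m ?f ?g"
      by (simp add: Hom_dual_balancing_def M.idm_closed)
    also have "\<dots> = ?\<Theta> m (?f \<cdot>\<^bsub>M\<^esub> ?g)"
      by (rule pairing_trace_cmp(2)[OF nat Hom_balancing_closed[OF f]
            Hom_cobalancing_closed[OF M.idm_closed]])
    also have "\<dots> = ?\<Theta> m (partial_trace C a M c m f)"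
      by (simp add: balancing_cmp_cobalancing[OF f M.idm_closed] M.cmp_idm[OF f])
    finally show ?thesis
      using pairing_trace_cmp(1)[OF nat f M.idm_closed] M.idm_cmp[OF f] by simp
  qed
  show ?thesis
    unfolding module_trace_def
    by (intro conjI allI ballI impI form sym nondeg nondeg' compat) auto
qed

section \<open>The correspondence\<close>

lemma bij_betw_trace_pairing:
  "bij_betw trace_pairing {\<Theta>. module_trace C a M \<Theta>}
    {\<eta>. natural_iso_Hom_dual M \<eta> \<and> balanced C a M \<eta>}"
proof (rule bij_betw_byWitness[where f' = pairing_trace])
  show "trace_pairing ` {\<Theta>. module_trace C a M \<Theta>} \<subseteq> {\<eta>. natural_iso_Hom_dual M \<eta> \<and> balanced C a M \<eta>}"
    using natural_iso_trace_pairing balanced_trace_pairing by blast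
  show "pairing_trace ` {\<eta>. natural_iso_Hom_dual M \<eta> \<and> balanced C a M \<eta>} \<subseteq> {\<Theta>. module_trace C a M \<Theta>}"
    using module_trace_pairing_trace by blast
  show "\<forall>\<Theta>\<in>{\<Theta>. module_trace C a M \<Theta>}. pairing_trace (trace_pairing \<Theta>) = \<Theta>"
    by (intro ballI pairing_trace_trace_pairing) simp
  show "\<forall>\<eta>\<in>{\<eta>. natural_iso_Hom_dual M \<eta> \<and> balanced C a M \<eta>}. trace_pairing (pairing_trace \<eta>) = \<eta>"
    by (intro ballI trace_pairing_pairing_trace) simp
qed

end

theorem theorem4p2:
  fixes C :: "('o, 'h) rigid_cat"
    and a :: "'o \<Rightarrow> 'h"
    and M :: "('n, 'k, 'o, 'h) mod_cat"
  assumes "fusion_category C"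
    and "pivotal_structure C a"
    and "module_category C M"
  shows "bij_betw
    (\<lambda>\<Theta> m n. \<lambda>f \<in> Mor M m n. \<lambda>g \<in> Mor M n m. \<Theta> m (g \<cdot>\<^bsub>M\<^esub> f))
    {\<Theta>. module_trace C a M \<Theta>}
    {\<eta>. natural_iso_Hom_dual M \<eta> \<and> balanced C a M \<eta>}"
proof -
  interpret pivotal_module_category C M a
    using assms by (intro pivotal_module_category.intro pivotal_module_category_axioms.intro)
  show ?thesis
    using bij_betw_trace_pairing unfolding trace_pairing_def[abs_def] .
qed

end
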